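(* There is a unique sequence $(a(n))_{n\ge 0}$ of nonnegative integers satisfying $a(0)=0$, $a(1)=1$ and $$a(n)=n-a\bigl(n-a\bigl(n-a(n-1)\bigr)\bigr)\qquad(n\ge 2)$$ (with all arguments occurring being nonnegative integers). With the greedy representation $\operatorname{rep}(n)$, the shift $\operatorname{shift}_2(n)$ and the $28$-state automata $E$ and $D$ with output specified in the context, for every $n\ge 0$: $$a(n)=\operatorname{shift}_2(n)+E(\operatorname{rep}(n)),\qquad a(n+1)-a(n)=D(\operatorname{rep}(n))\in\{0,1\}.$$ Let $c$ be the real root of $t^3-t^2+2t-1$. Then $$-1.049234<a(n)-cn<1.155081\qquad(n\ge 0).$$ Consequently $a(n)/n\to c$, and $$\{a(n)-\lfloor cn\rfloor : n\ge 1\}=\{-1,0,1,2\}.$$ The difference word $d(0)d(1)d(2)\cdots$, where $d(n)=a(n+1)-a(n)$, is morphic, is not ultimately periodic, and has least balance constant $4$. It admits the explicit $26$-letter non-erasing presentation $$d(0)d(1)d(2)\cdots=\eta\bigl(\nu^\omega(S)\bigr),$$ where $\nu$ and $\eta$ are the non-erasing morphisms listed in the context. Finally, the numbers $m=\inf_{n\ge0}(a(n)-cn)$ and $M=\sup_{n\ge 0}(a(n)-cn)$ are effectively approximable by rational intervals with a certified error tending to zero: there is an algorithm which, on input $k\in\mathbb N$, outputs rational intervals containing $m$ and $M$ respectively, together with a certified rational bound on their widths, this bound tending to $0$ as $k\to\infty$.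
   Context: **Weights.** $U_0,U_1,U_2,U_3,U_4=1,2,3,4,5$ and $U_p=U_{p-2}+U_{p-3}$ for $p\ge4$. **Greedy representation.** For $n\ge1$ the greedy representation selects the largest $U_p\le n$, then repeats with the remainder $n-U_p$ until the remainder is $0$; this gives a set $J$ of selected positions with $n=\sum_{p\in J}U_p$. The word $\operatorname{rep}(n)$ is the binary word $w_k\cdots w_0$ (most significant digit first, $w_k=1$) with $w_p=1$ iff $p\in J$; $\operatorname{rep}(0)$ is the empty word (with $J=\emptyset$). **Shift.** $\operatorname{shift}_2(n)=\sum_{p\in J,\ p\ge2}U_{p-2}$, where $J$ is the set of selected positions of $n$. **Automata with output.** $E$ and $D$ have states $0,\dots,27$ and initial state $0$, and read words from most to least significant digit; $E(w)$, resp. $D(w)$, denotes the output attached to the state reached after reading $w$. A dash means an undefined transition. $E$, written as state:(successor on digit 0, successor on digit 1, output): 0:(0,1,0); 1:(2,–,1); 2:(3,–,1); 3:(4,–,1); 4:(5,6,0); 5:(7,8,0); 6:(–,–,1); 7:(9,10,0); 8:(11,–,0); 9:(5,12,0); 10:(13,–,1); 11:(14,–,2); 12:(15,–,1); 13:(16,–,1); 14:(17,–,0); 15:(18,–,1); 16:(19,–,1); 17:(20,21,1); 18:(22,–,1); 19:(23,21,1); 20:(24,1,0); 21:(–,–,0); 22:(9,6,0); 23:(25,10,−1); 24:(26,1,0); 25:(20,27,1); 26:(23,8,1); 27:(15,–,0). $D$, in the same format: 0:(0,1,1); 1:(2,–,0); 2:(3,–,1); 3:(4,–,0); 4:(5,6,1);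 5:(7,8,1); 6:(–,–,0); 7:(9,10,0); 8:(11,–,1); 9:(5,12,1); 10:(13,–,1); 11:(14,–,0); 12:(15,–,0); 13:(16,–,0); 14:(17,–,1); 15:(18,–,1); 16:(19,–,1); 17:(20,21,0); 18:(22,–,1); 19:(23,21,0); 20:(24,1,0); 21:(–,–,1); 22:(9,21,0); 23:(25,10,1); 24:(26,1,1); 25:(20,27,0); 26:(23,8,0); 27:(15,–,1). **Morphisms.** Let $I=\{S,q_1,\dots,q_{27}\}\setminus\{q_6,q_{21}\}$ (26 letters). $\nu:I^*\to I^*$ and $\eta:I^*\to\{0,1\}^*$ are given by (letter: $\nu$-image; $\eta$-image): $S$: $S\,q_1$; $10$. $q_1$: $q_2$; $1$. $q_2$: $q_3$; $0$. $q_3$: $q_4$; $1$. $q_4$: $q_5$; $10$. $q_5$: $q_7\,q_8$; $01$. $q_7$: $q_9\,q_{10}$; $11$. $q_8$: $q_{11}$; $0$. $q_9$: $q_5\,q_{12}$; $10$. $q_{10}$: $q_{13}$; $0$. $q_{11}$: $q_{14}$; $1$. $q_{12}$: $q_{15}$; $1$. $q_{13}$: $q_{16}$; $1$. $q_{14}$: $q_{17}$; $0$. $q_{15}$: $q_{18}$; $1$. $q_{16}$: $q_{19}$; $0$. $q_{17}$: $q_{20}$; $01$. $q_{18}$: $q_{22}$; $0$. $q_{19}$: $q_{23}$; $11$. $q_{20}$: $q_{24}\,q_1$; $10$. $q_{22}$: $q_9$; $11$. $q_{23}$: $q_{25}\,q_{10}$; $01$. $q_{24}$: $q_{26}\,q_1$;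 $00$. $q_{25}$: $q_{20}\,q_{27}$; $01$. $q_{26}$: $q_{23}\,q_8$; $11$. $q_{27}$: $q_{15}$; $1$. $\nu^\omega(S)$ is the infinite word that is the limit of $\nu^k(S)$ as $k\to\infty$. A morphism is non-erasing if no letter has empty image. **Words.** An infinite word is morphic if it is the letter-to-letter image of the infinite fixed point $\mu^\omega(s)$ of a morphism $\mu$ on a finite alphabet prolongable on a letter $s$. A balance constant of an infinite binary word is a natural number $C$ such that for any two factors of equal length and each letter, the numbers of occurrences of that letter in the two factors differ by at most $C$; the least balance constant is the smallest such $C$. *)

theory Defs
  imports Complex_Main
begin

section \<open>The nested recurrence\<close>

text \<open>
  The recurrence is an identity in the integers. The two inequalities say that the arguments
  \<open>n - a (n - 1)\<close> and \<open>n - a (n - a (n - 1))\<close> are nonnegative, so that subtraction on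
  \<^typ>\<open>nat\<close> is never truncated.
\<close>

definition nested_recurrence :: "(nat \<Rightarrow> nat) \<Rightarrow> bool" where
  "nested_recurrence a \<longleftrightarrow>
     a 0 = 0 \<and> a 1 = 1 \<and>
     (\<forall>n\<ge>2. a (n - 1) \<le> n \<and> a (n - a (n - 1)) \<le> n \<and>
            int (a n) = int n - int (a (n - a (n - a (n - 1)))))"

definition diff_word :: "(nat \<Rightarrow> nat) \<Rightarrow> nat \<Rightarrow> int" where
  "diff_word a n = int (a (n + 1)) - int (a n)"

definition cubic_root :: real where
  "cubic_root = (THE t. t ^ 3 - t ^ 2 + 2 * t - 1 = 0)"


section \<open>Greedy representation and shift\<close>

text \<open>The prescribed value \<open>U 4 = 5\<close> agrees with the recurrence: \<open>U 4 = U 2 + U 1\<close>.\<close>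

fun U :: "nat \<Rightarrow> nat" where
  "U 0 = 1"
| "U (Suc 0) = 2"
| "U (Suc (Suc 0)) = 3"
| "U (Suc (Suc (Suc 0))) = 4"
| "U (Suc (Suc (Suc (Suc p)))) = U (Suc (Suc p)) + U (Suc p)"

lemma U_pos: "U p > 0"
  by (induction p rule: U.induct) auto

text \<open>
  \<^const>\<open>U\<close> is strictly increasing, so the largest weight not exceeding \<open>n\<close> is the one
  with the largest such position. No position is selected twice, since
  \<open>U (p + 1) \<le> 2 * U p\<close>; collecting the positions in a set therefore loses nothing.
\<close>

function greedy :: "nat \<Rightarrow> nat set" where
  "greedy n = (if n = 0 then {}
               else insert (GREATEST p. U p \<le> n) (greedy (n - U (GREATEST p. U p \<le> n))))"
  by auto
termination
  by (relation "measure id") (auto simp: U_pos)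

declare greedy.simps [simp del]

text \<open>Most significant digit first; \<^const>\<open>True\<close> is the digit 1.\<close>

definition rep :: "nat \<Rightarrow> bool list" where
  "rep n = (if n = 0 then [] else map (\<lambda>p. p \<in> greedy n) (rev [0..<Suc (Max (greedy n))]))"

definition shift2 :: "nat \<Rightarrow> nat" where
  "shift2 n = (\<Sum>p | p \<in> greedy n \<and> 2 \<le> p. U (p - 2))"


section \<open>Automata with output\<close>

text \<open>
  Entry \<open>q\<close> of the list consists of the successors of state \<open>q\<close> on the digits 0 and 1
  (\<^const>\<open>None\<close> if undefined) and the output at \<open>q\<close>; the initial state is 0.
\<close>

type_synonym output_automaton = "(nat option \<times> nat option \<times> int) list"

definition next_state :: "output_automaton \<Rightarrow> nat \<Rightarrow> bool \<Rightarrow> nat option" where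
  "next_state T q b = (case T ! q of (q0, q1, out) \<Rightarrow> if b then q1 else q0)"

fun run :: "output_automaton \<Rightarrow> nat \<Rightarrow> bool list \<Rightarrow> nat option" where
  "run T q [] = Some q"
| "run T q (b # w) = (case next_state T q b of None \<Rightarrow> None | Some q' \<Rightarrow> run T q' w)"

definition output_on :: "output_automaton \<Rightarrow> bool list \<Rightarrow> int option" where
  "output_on T w = map_option (\<lambda>q. snd (snd (T ! q))) (run T 0 w)"

definition E_aut :: output_automaton where
  "E_aut = [
    (Some 0, Some 1, 0),
    (Some 2, None, 1),
    (Some 3, None, 1),
    (Some 4, None, 1),
    (Some 5, Some 6, 0),
    (Some 7, Some 8, 0),
    (None, None, 1),
    (Some 9, Some 10, 0),
    (Some 11, None, 0),
    (Some 5, Some 12, 0),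
    (Some 13, None, 1),
    (Some 14, None, 2),
    (Some 15, None, 1),
    (Some 16, None, 1),
    (Some 17, None, 0),
    (Some 18, None, 1),
    (Some 19, None, 1),
    (Some 20, Some 21, 1),
    (Some 22, None, 1),
    (Some 23, Some 21, 1),
    (Some 24, Some 1, 0),
    (None, None, 0),
    (Some 9, Some 6, 0),
    (Some 25, Some 10, -1),
    (Some 26, Some 1, 0),
    (Some 20, Some 27, 1),
    (Some 23, Some 8, 1),
    (Some 15, None, 0)]"

definition D_aut :: output_automaton where
  "D_aut = [
    (Some 0, Some 1, 1),
    (Some 2, None, 0),
    (Some 3, None, 1),
    (Some 4, None, 0),
    (Some 5, Some 6, 1),
    (Some 7, Some 8, 1),
    (None, None, 0),
    (Some 9, Some 10, 0),
    (Some 11, None, 1),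
    (Some 5, Some 12, 1),
    (Some 13, None, 1),
    (Some 14, None, 0),
    (Some 15, None, 0),
    (Some 16, None, 0),
    (Some 17, None, 1),
    (Some 18, None, 1),
    (Some 19, None, 1),
    (Some 20, Some 21, 0),
    (Some 22, None, 1),
    (Some 23, Some 21, 0),
    (Some 24, Some 1, 0),
    (None, None, 1),
    (Some 9, Some 21, 0),
    (Some 25, Some 10, 1),
    (Some 26, Some 1, 1),
    (Some 20, Some 27, 0),
    (Some 23, Some 8, 0),
    (Some 15, None, 1)]"


section \<open>Words and morphisms\<close>

text \<open>
  An infinite word is a function on \<^typ>\<open>nat\<close>, and a morphism is given by its images of letters.
\<close>

definition apply_morphism :: "('a \<Rightarrow> 'b list) \<Rightarrow> 'a list \<Rightarrow> 'b list" where
  "apply_morphism f w = concat (map f w)"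

definition converges_to_word :: "(nat \<Rightarrow> 'a list) \<Rightarrow> (nat \<Rightarrow> 'a) \<Rightarrow> bool" where
  "converges_to_word u w \<longleftrightarrow> (\<forall>i. \<exists>K. \<forall>k\<ge>K. i < length (u k) \<and> u k ! i = w i)"

lemma converges_to_word_unique:
  assumes "converges_to_word u v" and "converges_to_word u w"
  shows "v = w"
proof
  fix i
  obtain K L where "\<forall>k\<ge>K. u k ! i = v i" and "\<forall>k\<ge>L. u k ! i = w i"
    using assms unfolding converges_to_word_def by meson
  then show "v i = w i" by (metis max.cobounded1 max.cobounded2)
qed

definition lim_word :: "(nat \<Rightarrow> 'a list) \<Rightarrow> nat \<Rightarrow> 'a" where
  "lim_word u = (THE w. converges_to_word u w)"

definition omega_word :: "('a \<Rightarrow> 'a list) \<Rightarrow> 'a \<Rightarrow> nat \<Rightarrow> 'a" where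
  "omega_word f s = lim_word (\<lambda>k. (apply_morphism f ^^ k) [s])"

definition apply_morphism_inf :: "('a \<Rightarrow> 'b list) \<Rightarrow> (nat \<Rightarrow> 'a) \<Rightarrow> nat \<Rightarrow> 'b" where
  "apply_morphism_inf f w = lim_word (\<lambda>k. apply_morphism f (map w [0..<k]))"

definition non_erasing :: "('a \<Rightarrow> 'b list) \<Rightarrow> bool" where
  "non_erasing f \<longleftrightarrow> (\<forall>x. f x \<noteq> [])"

text \<open>
  For morphisms that may erase letters, the last condition guarantees that the iterates on \<open>s\<close>
  grow to an infinite word.
\<close>

definition prolongable :: "('a \<Rightarrow> 'a list) \<Rightarrow> 'a \<Rightarrow> bool" where
  "prolongable f s \<longleftrightarrow>
     (\<exists>x. f s = s # x \<and> x \<noteq> [] \<and> (\<forall>k. (apply_morphism f ^^ k) x \<noteq> []))"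

text \<open>Every finite alphabet can be renamed to a finite set of natural numbers.\<close>

definition morphic :: "(nat \<Rightarrow> 'a) \<Rightarrow> bool" where
  "morphic w \<longleftrightarrow>
     (\<exists>(A :: nat set) f s g. finite A \<and> s \<in> A \<and> (\<forall>x\<in>A. set (f x) \<subseteq> A) \<and>
        prolongable f s \<and> w = (\<lambda>n. g (omega_word f s n)))"

definition ultimately_periodic :: "(nat \<Rightarrow> 'a) \<Rightarrow> bool" where
  "ultimately_periodic w \<longleftrightarrow> (\<exists>p>0. \<exists>N. \<forall>n\<ge>N. w (n + p) = w n)"

definition is_factor :: "'a list \<Rightarrow> (nat \<Rightarrow> 'a) \<Rightarrow> bool" where
  "is_factor u w \<longleftrightarrow> (\<exists>i. u = map w [i..<i + length u])"

definition balance_constant :: "(nat \<Rightarrow> 'a) \<Rightarrow> nat \<Rightarrow> bool" where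
  "balance_constant w C \<longleftrightarrow>
     (\<forall>u v x. is_factor u w \<and> is_factor v w \<and> length u = length v \<longrightarrow>
        \<bar>int (count_list u x) - int (count_list v x)\<bar> \<le> int C)"

definition least_balance_constant :: "(nat \<Rightarrow> 'a) \<Rightarrow> nat \<Rightarrow> bool" where
  "least_balance_constant w C \<longleftrightarrow>
     balance_constant w C \<and> (\<forall>C'. balance_constant w C' \<longrightarrow> C \<le> C')"

text \<open>The letter \<open>Qi\<close> is \<open>q\<^sub>i\<close>; there are no letters \<open>Q6\<close> and \<open>Q21\<close>.\<close>

datatype letter =
  S | Q1 | Q2 | Q3 | Q4 | Q5 | Q7 | Q8 | Q9 | Q10 | Q11 | Q12 | Q13
  | Q14 | Q15 | Q16 | Q17 | Q18 | Q19 | Q20 | Q22 | Q23 | Q24 | Q25 | Q26 | Q27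

primrec nu :: "letter \<Rightarrow> letter list" where
  "nu S = [S, Q1]"
| "nu Q1 = [Q2]"
| "nu Q2 = [Q3]"
| "nu Q3 = [Q4]"
| "nu Q4 = [Q5]"
| "nu Q5 = [Q7, Q8]"
| "nu Q7 = [Q9, Q10]"
| "nu Q8 = [Q11]"
| "nu Q9 = [Q5, Q12]"
| "nu Q10 = [Q13]"
| "nu Q11 = [Q14]"
| "nu Q12 = [Q15]"
| "nu Q13 = [Q16]"
| "nu Q14 = [Q17]"
| "nu Q15 = [Q18]"
| "nu Q16 = [Q19]"
| "nu Q17 = [Q20]"
| "nu Q18 = [Q22]"
| "nu Q19 = [Q23]"
| "nu Q20 = [Q24, Q1]"
| "nu Q22 = [Q9]"
| "nu Q23 = [Q25, Q10]"
| "nu Q24 = [Q26, Q1]"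
| "nu Q25 = [Q20, Q27]"
| "nu Q26 = [Q23, Q8]"
| "nu Q27 = [Q15]"

primrec eta :: "letter \<Rightarrow> int list" where
  "eta S = [1, 0]"
| "eta Q1 = [1]"
| "eta Q2 = [0]"
| "eta Q3 = [1]"
| "eta Q4 = [1, 0]"
| "eta Q5 = [0, 1]"
| "eta Q7 = [1, 1]"
| "eta Q8 = [0]"
| "eta Q9 = [1, 0]"
| "eta Q10 = [0]"
| "eta Q11 = [1]"
| "eta Q12 = [1]"
| "eta Q13 = [1]"
| "eta Q14 = [0]"
| "eta Q15 = [1]"
| "eta Q16 = [0]"
| "eta Q17 = [0, 1]"
| "eta Q18 = [0]"
| "eta Q19 = [1, 1]"
| "eta Q20 = [1, 0]"
| "eta Q22 = [1, 1]"
| "eta Q23 = [0, 1]"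
| "eta Q24 = [0, 0]"
| "eta Q25 = [0, 1]"
| "eta Q26 = [1, 1]"
| "eta Q27 = [1]"


section \<open>Algorithms\<close>

text \<open>
  The total recursive functions: the closure of the basic functions under composition, primitive
  recursion and minimisation of regular functions. Arguments are passed as a list; missing
  arguments count as 0 and superfluous ones are ignored, so no arities need to be tracked.
\<close>

definition arg :: "nat \<Rightarrow> nat list \<Rightarrow> nat" where
  "arg i xs = (if i < length xs then xs ! i else 0)"

inductive total_recursive :: "(nat list \<Rightarrow> nat) \<Rightarrow> bool" where
  zero: "total_recursive (\<lambda>xs. 0)"
| succ: "total_recursive (\<lambda>xs. Suc (arg 0 xs))"
| proj: "total_recursive (arg i)"
| comp: "total_recursive f \<Longrightarrow> \<forall>g\<in>set gs. total_recursive g \<Longrightarrow>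
    total_recursive (\<lambda>xs. f (map (\<lambda>g. g xs) gs))"
| prim_rec: "total_recursive f \<Longrightarrow> total_recursive g \<Longrightarrow>
    total_recursive (\<lambda>xs. rec_nat (f (tl xs)) (\<lambda>y r. g (r # y # tl xs)) (arg 0 xs))"
| minim: "total_recursive f \<Longrightarrow> \<forall>xs. \<exists>y. f (y # xs) = 0 \<Longrightarrow>
    total_recursive (\<lambda>xs. LEAST y. f (y # xs) = 0)"

definition computable_fun :: "(nat \<Rightarrow> nat) \<Rightarrow> bool" where
  "computable_fun f \<longleftrightarrow> (\<exists>F. total_recursive F \<and> (\<forall>k. F [k] = f k))"

text \<open>The output \<open>(p - q) / (r + 1)\<close> is coded by the natural numbers \<open>p\<close>, \<open>q\<close>, \<open>r\<close>.\<close>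

definition computable_rat_seq :: "(nat \<Rightarrow> rat) \<Rightarrow> bool" where
  "computable_rat_seq x \<longleftrightarrow>
     (\<exists>p q r. computable_fun p \<and> computable_fun q \<and> computable_fun r \<and>
        (\<forall>k. x k = (of_nat (p k) - of_nat (q k)) / of_nat (Suc (r k))))"

text \<open>
  On input \<open>k\<close> the algorithm outputs the intervals \<open>[l1 k, u1 k]\<close> and \<open>[l2 k, u2 k]\<close> for the
  two numbers, and the bound \<open>e k\<close> on both widths.
\<close>

definition effectively_approximable :: "real \<Rightarrow> real \<Rightarrow> bool" where
  "effectively_approximable x y \<longleftrightarrow>
     (\<exists>l1 u1 l2 u2 e.
        computable_rat_seq l1 \<and> computable_rat_seq u1 \<and>
        computable_rat_seq l2 \<and> computable_rat_seq u2 \<and> computable_rat_seq e \<and>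
        (\<forall>k. of_rat (l1 k) \<le> x \<and> x \<le> of_rat (u1 k) \<and>
             of_rat (l2 k) \<le> y \<and> y \<le> of_rat (u2 k) \<and>
             u1 k - l1 k \<le> e k \<and> u2 k - l2 k \<le> e k) \<and>
        (\<lambda>k. real_of_rat (e k)) \<longlonglongrightarrow> 0)"

end

theory Submission
  imports Defs
begin

text \<open>
  Removing the last digit of \<open>rep n\<close> gives \<open>rep m\<close> for a number \<open>m\<close>, the parent of \<open>n\<close>, and the
  states of \<open>0, 1, 2, \<dots>\<close> form a fixed point of the morphism that maps a state to the list of its
  successors. The candidate solution is the grandparent of \<open>n\<close> plus a correction depending on the
  state of \<open>n\<close>. Since the weights satisfy linear recurrences, the arguments occurring in the
  recurrence at \<open>n + 1\<close> exceed the third ancestor and the first ancestor of \<open>n\<close> by at most 3 and 2.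
  So the recurrence at \<open>n + 1\<close> only depends on the states of three consecutive numbers starting at
  the third ancestor of \<open>n\<close> and on the way down to \<open>n\<close>: finitely many cases, because the triples of
  consecutive states form a finite set closed under passing to children.

  The deviation \<open>a n - c n\<close> is a sum over the digits of \<open>n\<close> with weights decaying like
  \<open>0.87 ^ p\<close>. The bounds follow by maximising the contribution of the 120 lowest digits over all
  paths of the automaton; the balance constant and the values of \<open>a n - \<lfloor>c n\<rfloor>\<close> follow from the
  bounds together with explicit witnesses. The supremum and the infimum are approximated by the
  extrema over \<open>n < 2 ^ (k + 16)\<close>, the higher digits of any number being replaceable by a short
  word that leads to the same state.
\<close>

section \<open>The numeration tree\<close>

text \<open>The weights grow like \<open>rho ^ p\<close>, where \<open>rho\<close> is the real root
  of \<open>t ^ 3 = t + 1\<close>, and c equals \<open>1 / rho ^ 2\<close>. Dropping a digit divides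
  by about \<open>rho\<close>, so the grandparent of n is the natural integer approximation of c n,
  and the nested recurrence mirrors the identities \<open>1 = rho^-2 + rho^-3\<close> and
  \<open>1 = rho^-1 + rho^-5\<close>. On the weights both hold except at the lowest positions, and
  the states keep track of the resulting corrections. The value of the candidate at an argument that
  is only near an ancestor depends on the neighbours of that ancestor, which is why triples of
  states and not single states are followed. The other two roots of \<open>t ^ 3 = t + 1\<close> are
  complex of modulus \<open>rho ^ (-1/2)\<close>, just below 0.87; this keeps the deviation bounded.
  By \<open>t ^ 5 = t ^ 4 + 1\<close> the gap above a weight is the weight four places lower, so
  greedy digits 1 are at least five places apart. The single exception,
  \<open>U 5 - U 4 = U 0 + 1\<close>, allows distance four at the very end of a word and produces
  the leaves of the tree.\<close>

text \<open>
  Apart from the transition from \<open>q\<^sub>2\<^sub>2\<close> on digit 1, the automata have the same transitions; the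
  node \<open>X28\<close> stands for state 6 of the first and state 21 of the second automaton.
\<close>

datatype node = N letter | X6 | X21 | X28

primrec children :: "letter \<Rightarrow> node list" where
  "children S = [N S, N Q1]" | "children Q1 = [N Q2]" | "children Q2 = [N Q3]"
| "children Q3 = [N Q4]" | "children Q4 = [N Q5, X6]" | "children Q5 = [N Q7, N Q8]"
| "children Q7 = [N Q9, N Q10]" | "children Q8 = [N Q11]" | "children Q9 = [N Q5, N Q12]"
| "children Q10 = [N Q13]" | "children Q11 = [N Q14]" | "children Q12 = [N Q15]"
| "children Q13 = [N Q16]" | "children Q14 = [N Q17]" | "children Q15 = [N Q18]"
| "children Q16 = [N Q19]" | "children Q17 = [N Q20, X21]" | "children Q18 = [N Q22]"
| "children Q19 = [N Q23, X21]" | "children Q20 = [N Q24, N Q1]" | "children Q22 = [N Q9, X28]"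
| "children Q23 = [N Q25, N Q10]" | "children Q24 = [N Q26, N Q1]"
| "children Q25 = [N Q20, N Q27]" | "children Q26 = [N Q23, N Q8]" | "children Q27 = [N Q15]"

primrec index :: "letter \<Rightarrow> nat" where
  "index S = 0" | "index Q1 = 1" | "index Q2 = 2" | "index Q3 = 3" | "index Q4 = 4"
| "index Q5 = 5" | "index Q7 = 7" | "index Q8 = 8" | "index Q9 = 9" | "index Q10 = 10"
| "index Q11 = 11" | "index Q12 = 12" | "index Q13 = 13" | "index Q14 = 14" | "index Q15 = 15"
| "index Q16 = 16" | "index Q17 = 17" | "index Q18 = 18" | "index Q19 = 19" | "index Q20 = 20"
| "index Q22 = 22" | "index Q23 = 23" | "index Q24 = 24" | "index Q25 = 25" | "index Q26 = 26"
| "index Q27 = 27"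

primrec letter_e :: "letter \<Rightarrow> int" where
  "letter_e S = 0" | "letter_e Q1 = 1" | "letter_e Q2 = 1" | "letter_e Q3 = 1"
| "letter_e Q4 = 0" | "letter_e Q5 = 0" | "letter_e Q7 = 0" | "letter_e Q8 = 0"
| "letter_e Q9 = 0" | "letter_e Q10 = 1" | "letter_e Q11 = 2" | "letter_e Q12 = 1"
| "letter_e Q13 = 1" | "letter_e Q14 = 0" | "letter_e Q15 = 1" | "letter_e Q16 = 1"
| "letter_e Q17 = 1" | "letter_e Q18 = 1" | "letter_e Q19 = 1" | "letter_e Q20 = 0"
| "letter_e Q22 = 0" | "letter_e Q23 = -1" | "letter_e Q24 = 0" | "letter_e Q25 = 1"
| "letter_e Q26 = 1" | "letter_e Q27 = 0"

primrec letter_d :: "letter \<Rightarrow> int" where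
  "letter_d S = 1" | "letter_d Q1 = 0" | "letter_d Q2 = 1" | "letter_d Q3 = 0"
| "letter_d Q4 = 1" | "letter_d Q5 = 1" | "letter_d Q7 = 0" | "letter_d Q8 = 1"
| "letter_d Q9 = 1" | "letter_d Q10 = 1" | "letter_d Q11 = 0" | "letter_d Q12 = 0"
| "letter_d Q13 = 0" | "letter_d Q14 = 1" | "letter_d Q15 = 1" | "letter_d Q16 = 1"
| "letter_d Q17 = 0" | "letter_d Q18 = 1" | "letter_d Q19 = 0" | "letter_d Q20 = 0"
| "letter_d Q22 = 0" | "letter_d Q23 = 1" | "letter_d Q24 = 1" | "letter_d Q25 = 0"
| "letter_d Q26 = 0" | "letter_d Q27 = 1"

text \<open>The number of digits from the last 1 on, where 0 stands for at least 5. After fewer than 4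
  digits no further 1 is allowed, and after exactly 4 only as the final digit.\<close>

primrec age :: "letter \<Rightarrow> nat" where
  "age S = 0" | "age Q1 = 1" | "age Q2 = 2" | "age Q3 = 3" | "age Q4 = 4" | "age Q5 = 0"
| "age Q7 = 0" | "age Q8 = 1" | "age Q9 = 0" | "age Q10 = 1" | "age Q11 = 2" | "age Q12 = 1"
| "age Q13 = 2" | "age Q14 = 3" | "age Q15 = 2" | "age Q16 = 3" | "age Q17 = 4" | "age Q18 = 3"
| "age Q19 = 4" | "age Q20 = 0" | "age Q22 = 4" | "age Q23 = 0" | "age Q24 = 0" | "age Q25 = 0"
| "age Q26 = 0" | "age Q27 = 1"

primrec psi :: "node \<Rightarrow> node list" where
  "psi (N x) = children x" | "psi X6 = []" | "psi X21 = []" | "psi X28 = []"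

primrec E_of :: "node \<Rightarrow> int" where
  "E_of (N x) = letter_e x" | "E_of X6 = 1" | "E_of X21 = 0" | "E_of X28 = 1"

primrec D_of :: "node \<Rightarrow> int" where
  "D_of (N x) = letter_d x" | "D_of X6 = 0" | "D_of X21 = 1" | "D_of X28 = 1"

primrec E_state :: "node \<Rightarrow> nat" where
  "E_state (N x) = index x" | "E_state X6 = 6" | "E_state X21 = 21" | "E_state X28 = 6"

primrec D_state :: "node \<Rightarrow> nat" where
  "D_state (N x) = index x" | "D_state X6 = 6" | "D_state X21 = 21" | "D_state X28 = 21"

section \<open>Paths in the tree and runs of the automata\<close>

definition step :: "node \<Rightarrow> bool \<Rightarrow> node option" where
  "step q b = (if of_bool b < length (psi q) then Some (psi q ! of_bool b) else None)"

fun path :: "node \<Rightarrow> bool list \<Rightarrow> node option" where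
  "path q [] = Some q"
| "path q (b # w) = (case step q b of None \<Rightarrow> None | Some r \<Rightarrow> path r w)"

lemma path_append:
  "path q (v @ w) = (case path q v of None \<Rightarrow> None | Some r \<Rightarrow> path r w)"
  by (induction v arbitrary: q) (auto split: option.split)

lemma path_Cons_iff:
  "path q (b # w) = Some r \<longleftrightarrow> (\<exists>q'. step q b = Some q' \<and> path q' w = Some r)"
  by (auto split: option.split)

lemma next_state_E: "next_state E_aut (E_state q) b = map_option E_state (step q b)"
  and next_state_D: "next_state D_aut (D_state q) b = map_option D_state (step q b)"
  and E_output: "snd (snd (E_aut ! E_state q)) = E_of q"
  and D_output: "snd (snd (D_aut ! D_state q)) = D_of q"
     apply (cases q; cases b)
            prefer 1 subgoal for x by (cases x) (simp_all add: next_state_def E_aut_def step_def)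
           prefer 1 subgoal for x by (cases x) (simp_all add: next_state_def E_aut_def step_def)
          apply (simp_all add: next_state_def E_aut_def step_def)[6]
    apply (cases q; cases b)
           prefer 1 subgoal for x by (cases x) (simp_all add: next_state_def D_aut_def step_def)
          prefer 1 subgoal for x by (cases x) (simp_all add: next_state_def D_aut_def step_def)
         apply (simp_all add: next_state_def D_aut_def step_def)[6]
   apply (cases q)
      subgoal for x by (cases x) (simp_all add: E_aut_def)
     apply (simp_all add: E_aut_def)[3]
  apply (cases q)
     subgoal for x by (cases x) (simp_all add: D_aut_def)
    apply (simp_all add: D_aut_def)[3]
  done

lemma run_E: "run E_aut (E_state q) w = map_option E_state (path q w)"
  by (induction w arbitrary: q) (auto simp: next_state_E split: option.split)

lemma run_D: "run D_aut (D_state q) w = map_option D_state (path q w)"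
  by (induction w arbitrary: q) (auto simp: next_state_D split: option.split)

lemma output_E: "output_on E_aut w = map_option E_of (path (N S) w)"
  using run_E[of "N S" w] by (auto simp: output_on_def E_output option.map_comp o_def)

lemma output_D: "output_on D_aut w = map_option D_of (path (N S) w)"
  using run_D[of "N S" w] by (auto simp: output_on_def D_output option.map_comp o_def)


section \<open>The weights and the number of words below a node\<close>

lemma U_less_Suc: "U p < U (Suc p)"
proof (induction p rule: U.induct)
  case (5 p)
  show ?case
  proof (cases p)
    case (Suc r)
    show ?thesis using 5 Suc U_pos[of "Suc r"] by (cases r) auto
  qed auto
qed auto

lemma U_strict_mono: "strict_mono U"
  by (simp add: U_less_Suc strict_mono_Suc_iff)

text \<open>The sparser recurrence comes from
  \<open>t ^ 5 - t ^ 4 - 1 = (t ^ 3 - t - 1) * (t ^ 2 - t + 1)\<close>. The exception at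
  \<open>k = 0\<close> stems from \<open>U 3 = 4\<close>, which is not
  \<open>U 1 + U 0\<close>.\<close>

lemma U_growth: "U (k + 5) = U (k + 4) + U k + of_bool (k = 0)"
proof (induction k rule: less_induct)
  case (less k)
  show ?case
  proof (cases "k < 4")
    case True
    then have "k = 0 \<or> k = 1 \<or> k = 2 \<or> k = 3" by auto
    then show ?thesis by (auto simp: numeral_eq_Suc)
  next
    case False
    then obtain r where k: "k = r + 4" by (metis add.commute le_Suc_ex not_less)
    have "U (k + 5) = U (r + 2 + 5) + U (r + 1 + 5)" "U (k + 4) = U (r + 2 + 4) + U (r + 1 + 4)"
      "U k = U (r + 2) + U (r + 1)"
      unfolding k by (simp_all add: numeral_eq_Suc)
    then show ?thesis using less[of "r + 2"] less[of "r + 1"] k by simp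
  qed
qed

text \<open>The number of words of length \<open>k\<close> that can be read from a node.\<close>

definition cap :: "node \<Rightarrow> nat \<Rightarrow> nat" where
  "cap q k = (case q of N x \<Rightarrow> (if age x = 0 then U k else U (k + age x) - U (k + age x - 1))
     | _ \<Rightarrow> of_bool (k = 0))"

lemma cap_simps [simp]:
  "cap (N x) k = (if age x = 0 then U k else U (k + age x) - U (k + age x - 1))"
  "cap X6 k = of_bool (k = 0)" "cap X21 k = of_bool (k = 0)" "cap X28 k = of_bool (k = 0)"
  by (simp_all add: cap_def)

lemma U_le_Suc: "U p \<le> U (Suc p)"
  using U_less_Suc[of p] by simp

lemma cap_0: "cap q 0 = 1"
  by (cases q; simp; rename_tac x; case_tac x) (simp_all add: numeral_eq_Suc)

text \<open>The closed form in \<open>cap\<close> counts the remainders left by the greedy choice: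
  at age \<open>a > 0\<close> with \<open>k\<close> digits to go, the last 1 has weight
  \<open>U (k + a - 1)\<close>, and the remainder is less than the gap to the next weight. After age
  4, \<open>U_growth\<close> turns this gap back into a full weight, plus the leaf.\<close>

lemma cap_Suc: "cap q (Suc k) = (\<Sum>r\<leftarrow>psi q. cap r k)"
proof (cases q)
  case (N x)
  have "U (k + 5) - U (k + 4) = U k + of_bool (k = 0)"
    using U_growth[of k] by simp
  then show ?thesis
    using U_le_Suc[of k] unfolding N by (cases x) (simp_all add: numeral_eq_Suc)
qed simp_all

text \<open>A digit 1 that can be followed by further digits stands next to a digit 0 below which
  every value smaller than the weight of that 1 is available.\<close>

lemma cap_step_True: "step q True = Some r \<Longrightarrow> \<exists>r'. step q False = Some r' \<and> psi q = [r', r] \<and>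
    (\<forall>k. 0 < cap r k \<longrightarrow> cap r' k = U k) \<and> (\<forall>k. cap r k \<le> U (Suc k) - U k)"
proof (cases q)
  case (N x)
  assume "step q True = Some r"
  then show ?thesis
    using U_le_Suc unfolding N step_def
    by (cases x) (auto simp: numeral_eq_Suc)
qed (simp_all add: step_def)

lemma cap_step_False: "step q False = Some r \<Longrightarrow> cap r k \<le> cap q (Suc k)"
  by (simp add: cap_Suc step_def split: if_splits) (cases "psi q"; simp)


section \<open>Values of words and greedy representations\<close>

fun val :: "bool list \<Rightarrow> nat" where
  "val [] = 0"
| "val (b # w) = of_bool b * U (length w) + val w"

fun ones :: "bool list \<Rightarrow> nat set" where
  "ones [] = {}"
| "ones (b # w) = (if b then {length w} else {}) \<union> ones w"

lemma ones_less: "p \<in> ones w \<Longrightarrow> p < length w"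
  by (induction w) (auto split: if_splits)

text \<open>Lexicographic order of words of equal length is the order of their values: by
  \<open>cap_step_True\<close>, the words below digit 1 start with the value at which those below
  digit 0 stop. Together with \<open>path_exists\<close>, every value below \<open>cap\<close> is
  taken.\<close>

lemma val_less_cap: "path q w = Some r \<Longrightarrow> val w < cap q (length w)"
proof (induction w arbitrary: q)
  case Nil
  then show ?case by (simp add: cap_0)
next
  case (Cons b w)
  then obtain q' where q': "step q b = Some q'" "path q' w = Some r"
    unfolding path_Cons_iff by blast
  with Cons.IH have *: "val w < cap q' (length w)" by blast
  show ?case
  proof (cases b)
    case True
    with cap_step_True[of q q'] q' obtain r' where "psi q = [r', q']"
      "\<forall>k. 0 < cap q' k \<longrightarrow> cap r' k = U k" by auto
    then have "cap q (Suc (length w)) = U (length w) + cap q' (length w)"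
      using * by (simp add: cap_Suc)
    then show ?thesis using * True by simp
  next
    case False
    then show ?thesis using * cap_step_False[of q q' "length w"] q' by auto
  qed
qed

lemma path_exists: "n < cap q k \<Longrightarrow> \<exists>w r. length w = k \<and> path q w = Some r \<and> val w = n"
proof (induction k arbitrary: q n)
  case 0
  then show ?case by (simp add: cap_0)
next
  case (Suc k)
  show ?case
  proof (cases "psi q")
    case Nil
    then show ?thesis using Suc.prems by (simp add: cap_Suc)
  next
    case (Cons r l)
    have r: "step q False = Some r" by (simp add: step_def Cons)
    show ?thesis
    proof (cases "n < cap r k")
      case True
      then obtain w t where "length w = k" "path r w = Some t" "val w = n" using Suc.IH by blast
      then show ?thesis using r by (intro exI[of _ "False # w"]) simp
    next
      case False
      have "l \<noteq> []" using False Suc.prems by (auto simp: cap_Suc Cons)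
      then obtain r' where r': "step q True = Some r'" by (auto simp: step_def Cons)
      with cap_step_True[OF r'] Cons have l: "l = [r']" and u: "0 < cap r' k \<longrightarrow> cap r k = U k"
        by auto
      with False Suc.prems have "n - U k < cap r' k" "U k \<le> n" by (auto simp: cap_Suc Cons)
      then obtain w t where "length w = k" "path r' w = Some t" "val w = n - U k"
        using Suc.IH by blast
      then show ?thesis using r' \<open>U k \<le> n\<close> by (intro exI[of _ "True # w"]) simp
    qed
  qed
qed

text \<open>Below a leading 1 the rest of the word is smaller than the gap to the next weight, so
  the greedy algorithm selects exactly this position and continues with the rest.\<close>

lemma greedy_val: "path q w = Some r \<Longrightarrow> greedy (val w) = ones w"
proof (induction w arbitrary: q)
  case Nil
  then show ?case by (simp add: greedy.simps)
next
  case (Cons b w)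
  then obtain q' where q': "step q b = Some q'" "path q' w = Some r"
    unfolding path_Cons_iff by blast
  show ?case
  proof (cases b)
    case True
    have "val w < U (Suc (length w)) - U (length w)"
      using cap_step_True[of q q'] q' True val_less_cap[OF q'(2)] by (auto intro: less_le_trans)
    then have "val (b # w) < U (Suc (length w))" and ge: "U (length w) \<le> val (b # w)"
      using True by auto
    then have "p \<le> length w" if "U p \<le> val (b # w)" for p
      using strict_mono_less[OF U_strict_mono, of p "Suc (length w)"] that by simp
    then have "(GREATEST p. U p \<le> val (b # w)) = length w"
      using ge by (intro Greatest_equality) auto
    moreover have "val (b # w) \<noteq> 0" using True U_pos[of "length w"] by simp
    ultimately have "greedy (val (b # w)) = insert (length w) (greedy (val w))"
      using True by (subst greedy.simps) simp
    then show ?thesis using Cons.IH q' True by simp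
  next
    case False
    then show ?thesis using Cons.IH q' by simp
  qed
qed

lemma ones_inject: "length v = length w \<Longrightarrow> ones v = ones w \<Longrightarrow> v = w"
proof (induction v w rule: list_induct2)
  case (Cons a v b w)
  have "length v \<notin> ones v" "length w \<notin> ones w" using ones_less by blast+
  then have "a = b" using Cons.prems Cons.hyps by (auto split: if_splits)
  moreover have "ones v = ones w"
    using Cons.prems Cons.hyps \<open>a = b\<close> \<open>length v \<notin> ones v\<close> \<open>length w \<notin> ones w\<close>
    by (auto simp: insert_ident split: if_splits)
  ultimately show ?case using Cons.IH by simp
qed simp

lemma val_inject:
  assumes "path q v = Some r" "path q' w = Some r'" "length v = length w" "val v = val w"
  shows "v = w"
  using assms greedy_val ones_inject by metis

lemma map_ones: "map (\<lambda>p. p \<in> ones w) (rev [0..<length w]) = w"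
proof (induction w)
  case (Cons b w)
  have "map (\<lambda>p. p \<in> ones (b # w)) (rev [0..<length w]) = map (\<lambda>p. p \<in> ones w) (rev [0..<length w])"
    by (auto split: if_splits)
  then show ?case using Cons ones_less[of "length w" w] by auto
qed simp

lemma rep_val:
  assumes "path q w = Some r" "w = [] \<or> hd w"
  shows "rep (val w) = w"
proof (cases w)
  case (Cons b v)
  with assms have b: b by simp
  have "val w \<noteq> 0" using Cons b U_pos[of "length v"] by simp
  moreover have "Max (ones w) = length v"
    using Cons b ones_less[of _ v]
    by (intro Max_eqI finite_subset[of "ones w" "{..<length w}"]) (auto dest: ones_less intro: less_imp_le split: if_splits)
  ultimately show ?thesis
    using greedy_val[OF assms(1)] map_ones[of w] Cons by (simp add: rep_def)
qed (simp add: rep_def)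

lemma path_leading_zeros: "path (N S) (replicate j False @ w) = path (N S) w"
  by (induction j) (simp_all add: step_def)

lemma val_leading_zeros: "val (replicate j False @ w) = val w"
  by (induction j) simp_all

lemma U_ge: "p < U p"
proof (induction p)
  case (Suc p)
  then show ?case using U_less_Suc[of p] by simp
qed simp

section \<open>Zero-padded words and the state of a number\<close>

definition state :: "nat \<Rightarrow> node" where
  "state n = the (path (N S) (rep n))"

lemma dropWhile_zeros: "\<exists>j. w = replicate j False @ dropWhile Not w"
proof (induction w)
  case (Cons b w)
  then obtain j where "w = replicate j False @ dropWhile Not w" by blast
  then show ?case by (cases b) (auto intro: exI[of _ 0] exI[of _ "Suc j"])
qed simp

lemma path_rep: assumes "path (N S) w = Some r"
  shows "path (N S) (rep (val w)) = Some r" "\<exists>j. w = replicate j False @ rep (val w)"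
proof -
  obtain j where j: "w = replicate j False @ dropWhile Not w" using dropWhile_zeros by blast
  let ?v = "dropWhile Not w"
  have v: "path (N S) ?v = Some r" using assms path_leading_zeros j by metis
  have "rep (val ?v) = ?v"
    by (rule rep_val[OF v]) (metis (full_types) hd_dropWhile)
  moreover have "val ?v = val w" using val_leading_zeros j by metis
  ultimately show "path (N S) (rep (val w)) = Some r" "\<exists>j. w = replicate j False @ rep (val w)"
    using v j by auto
qed

lemma state_val: "path (N S) w = Some r \<Longrightarrow> state (val w) = r"
  using path_rep(1) by (simp add: state_def)

text \<open>Later arguments pad with leading zeros at will, so that a number always has enough
  digits to split off; \<open>S\<close> loops on digit 0.\<close>

lemma ex_word: assumes "n < U k"
  shows "\<exists>w. length w = k \<and> path (N S) w = Some (state n) \<and> val w = n"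
  using path_exists[of n "N S" k] assms state_val by auto

lemma path_rep_state: "path (N S) (rep n) = Some (state n)" and val_rep: "val (rep n) = n"
  using ex_word[OF U_ge, of n] path_rep(1)[of _ "state n"] path_rep(2)[of _ "state n"]
    val_leading_zeros by metis+

section \<open>Levels of the tree, parents and children\<close>

definition kids :: "node \<Rightarrow> (bool \<times> node) list" where
  "kids q = zip [False, True] (psi q)"

lemma length_psi: "length (psi q) \<le> 2"
  by (cases q; simp; rename_tac x; case_tac x) simp_all

lemma psi_cases:
  obtains "psi q = []" | r where "psi q = [r]" | r r' where "psi q = [r, r']"
  using length_psi[of q] by (cases "psi q"; cases "tl (psi q)") auto

lemma map_snd_kids: "map snd (kids q) = psi q"
  by (cases q rule: psi_cases) (simp_all add: kids_def)

lemma set_kids: "(b, r) \<in> set (kids q) \<longleftrightarrow> step q b = Some r"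
  by (cases q rule: psi_cases; cases b) (auto simp: kids_def step_def)

text \<open>A level of the tree from left to right, with the words leading to it. Unfolding at the
  root shows that the values run through an interval (\<open>map_val_nodes\<close>); unfolding at
  the bottom (\<open>nodes_append\<close>) exhibits the children of each number.\<close>

fun nodes :: "node \<Rightarrow> nat \<Rightarrow> (bool list \<times> node) list" where
  "nodes q 0 = [([], q)]"
| "nodes q (Suc k) = concat (map (\<lambda>(b, r). map (apfst ((#) b)) (nodes r k)) (kids q))"

lemma nodes_append:
  "nodes q (Suc k) = concat (map (\<lambda>(w, t). map (\<lambda>(b, r). (w @ [b], r)) (kids t)) (nodes q k))"
proof (induction k arbitrary: q)
  case 0
  have "concat (map (\<lambda>(b, r). [([b], r)]) l) = map (\<lambda>(b, r). ([b], r)) l"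
    for l :: "(bool \<times> node) list"
    by (induction l) auto
  then show ?case by simp
next
  case (Suc k)
  have *: "map (apfst ((#) b)) (nodes r (Suc k)) =
      concat (map (\<lambda>(w, t). map (\<lambda>(b, r). (w @ [b], r)) (kids t)) (map (apfst ((#) b)) (nodes r k)))"
    for b r
    unfolding Suc.IH by (simp add: map_concat o_def split_def apfst_def map_prod_def)
  have "concat (map (\<lambda>p. concat (f p)) l) = concat (concat (map f l))"
    for f :: "bool \<times> node \<Rightarrow> (bool list \<times> node) list list" and l
    by (induction l) auto
  then show ?case
    unfolding nodes.simps(2)[of q "Suc k"] * unfolding nodes.simps(2)[of q k]
    by (simp add: map_concat o_def split_def apfst_def map_prod_def del: nodes.simps)
qed

lemma set_nodes: "(w, t) \<in> set (nodes q k) \<longleftrightarrow> length w = k \<and> path q w = Some t"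
proof (induction k arbitrary: q w)
  case (Suc k)
  have "(w, t) \<in> set (nodes q (Suc k)) \<longleftrightarrow>
      (\<exists>b r v. step q b = Some r \<and> (v, t) \<in> set (nodes r k) \<and> w = b # v)"
    by (force simp: set_kids[symmetric])
  then show ?case
    unfolding Suc.IH by (cases w) (auto simp: path_Cons_iff simp del: path.simps(2))
qed auto

lemma map_val_nodes: "map (val \<circ> fst) (nodes q k) = [0..<cap q k]"
proof (induction k arbitrary: q)
  case 0
  then show ?case by (simp add: cap_0)
next
  case (Suc k)
  have l: "length w = k" if "(w, t) \<in> set (nodes r k)" for w t r
    using that by (simp add: set_nodes)
  have F: "map (val \<circ> fst) (map (apfst ((#) False)) (nodes r k)) = [0..<cap r k]" for r
    using Suc.IH[of r] by (simp add: o_def split_def)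
  have T: "map (val \<circ> fst) (map (apfst ((#) True)) (nodes r k)) = map ((+) (U k)) [0..<cap r k]" for r
    unfolding Suc.IH[of r, symmetric] using l by auto
  show ?case
  proof (cases q rule: psi_cases)
    case (3 r r')
    then have "step q True = Some r'" by (simp add: step_def)
    with cap_step_True[OF this] 3 have u: "0 < cap r' k \<longrightarrow> cap r k = U k" by auto
    have "map ((+) (U k)) [0..<cap r' k] = map ((+) (cap r k)) [0..<cap r' k]"
      using u by (cases "cap r' k = 0") auto
    also have "\<dots> = [cap r k..<cap r k + cap r' k]"
      by (rule nth_equalityI) auto
    finally show ?thesis
      using 3 F[of r] T[of r'] upt_add_eq_append[of 0 "cap r k" "cap r' k"]
      by (simp add: kids_def cap_Suc o_def)
  qed (use F in \<open>simp_all add: kids_def cap_Suc o_def\<close>)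
qed

lemma length_nodes: "length (nodes q k) = cap q k"
  using arg_cong[OF map_val_nodes[of q k], of length] by simp

lemma nodes_nth:
  assumes "i < U k"
  shows "path (N S) (fst (nodes (N S) k ! i)) = Some (state i)"
    "snd (nodes (N S) k ! i) = state i" "val (fst (nodes (N S) k ! i)) = i"
    "length (fst (nodes (N S) k ! i)) = k"
proof -
  obtain w t where wt: "nodes (N S) k ! i = (w, t)" by fastforce
  have i: "i < length (nodes (N S) k)" using assms by (simp add: length_nodes)
  then have "length w = k" "path (N S) w = Some t" using set_nodes wt nth_mem by metis+
  moreover have "val w = i"
    using arg_cong[OF map_val_nodes[of "N S" k], of "\<lambda>l. l ! i"] i wt assms by simp
  ultimately show "path (N S) (fst (nodes (N S) k ! i)) = Some (state i)"
    "snd (nodes (N S) k ! i) = state i" "val (fst (nodes (N S) k ! i)) = i"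
    "length (fst (nodes (N S) k ! i)) = k"
    using wt state_val by auto
qed

lemma map_snd_nodes: "map snd (nodes q k) = (apply_morphism psi ^^ k) [q]"
proof (induction k)
  case (Suc k)
  show ?case unfolding nodes_append
    by (simp add: Suc[symmetric] map_concat o_def split_def map_snd_kids)
       (simp add: apply_morphism_def o_def)
qed simp

lemma map_state: "map state [0..<U k] = (apply_morphism psi ^^ k) [N S]"
  unfolding map_snd_nodes[symmetric]
  by (rule nth_equalityI) (simp_all add: length_nodes nodes_nth)

definition first_child :: "nat \<Rightarrow> nat" where
  "first_child m = (\<Sum>i<m. length (psi (state i)))"

lemma first_child_0 [simp]: "first_child 0 = 0"
  and first_child_Suc: "first_child (Suc m) = first_child m + length (psi (state m))"
  by (simp_all add: first_child_def)

lemma nth_concat_map: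
  "m < length xs \<Longrightarrow> b < length (f (xs ! m)) \<Longrightarrow>
    concat (map f xs) ! ((\<Sum>i<m. length (f (xs ! i))) + b) = f (xs ! m) ! b \<and>
    (\<Sum>i<m. length (f (xs ! i))) + b < length (concat (map f xs))"
proof (induction xs arbitrary: m)
  case (Cons x xs)
  then show ?case
    by (cases m) (auto simp: nth_append sum.lessThan_Suc_shift simp del: sum.lessThan_Suc)
qed simp

text \<open>Each level lists the numbers in increasing order, so the children of
  \<open>val w\<close> come directly after the children of all smaller numbers.\<close>

lemma child_val:
  assumes "path (N S) (w @ [b]) = Some r"
  shows "val (w @ [b]) = first_child (val w) + of_bool b"
proof -
  obtain t where t: "path (N S) w = Some t" "step t b = Some r"
    using assms by (auto simp: path_append split: option.splits)
  let ?k = "length w" and ?m = "val w"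
  have m: "?m < U ?k" using val_less_cap[OF t(1)] by simp
  have w: "nodes (N S) ?k ! ?m = (w, t)"
    using nodes_nth[OF m] val_inject[of _ _ t] t(1) by (metis prod.collapse state_val)
  let ?f = "\<lambda>(w, t). map (\<lambda>(b, r). (w @ [b], r)) (kids t)"
  have l: "length (?f (nodes (N S) ?k ! i)) = length (psi (state i))" if "i < U ?k" for i
    using nodes_nth(2)[OF that] map_snd_kids by (metis (no_types, lifting) split_def length_map)
  have b: "of_bool b < length (psi t)" "psi t ! of_bool b = r"
    using t(2) by (auto simp: step_def split: if_splits)
  have s: "(\<Sum>i<?m. length (?f (nodes (N S) ?k ! i))) = first_child ?m"
    unfolding first_child_def using m by (intro sum.cong) (auto intro!: l simp del: split_beta)
  have "concat (map ?f (nodes (N S) ?k)) ! (first_child ?m + of_bool b) =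
      ?f (nodes (N S) ?k ! ?m) ! of_bool b \<and>
      first_child ?m + of_bool b < length (concat (map ?f (nodes (N S) ?k)))"
    unfolding s[symmetric]
    by (rule nth_concat_map) (use m w b(1) map_snd_kids[of t] in \<open>auto simp: length_nodes kids_def\<close>)
  moreover have "?f (w, t) ! of_bool b = (w @ [b], r)"
    using b by (cases t rule: psi_cases; cases b) (auto simp: kids_def)
  ultimately have *: "nodes (N S) (Suc ?k) ! (first_child ?m + of_bool b) = (w @ [b], r)"
    and "first_child ?m + of_bool b < length (nodes (N S) (Suc ?k))"
    unfolding nodes_append w by simp_all
  then have "first_child ?m + of_bool b < U (Suc ?k)" by (simp add: length_nodes del: nodes.simps)
  from nodes_nth(3)[OF this] * show ?thesis by simp
qed

definition parent :: "nat \<Rightarrow> nat" where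
  "parent n = val (butlast (rep n))"

text \<open>\<open>rep 0\<close> is empty; its last digit is taken to be 0, in agreement with
  zero-padded words.\<close>

definition digit :: "nat \<Rightarrow> nat" where
  "digit n = of_bool (n \<noteq> 0 \<and> last (rep n))"

lemma parent_val:
  assumes "path (N S) (w @ [b]) = Some r"
  shows "parent (val (w @ [b])) = val w" "digit (val (w @ [b])) = of_bool b"
proof -
  obtain j where j: "w @ [b] = replicate j False @ rep (val (w @ [b]))"
    using path_rep(2)[OF assms] by blast
  have "parent (val (w @ [b])) = val w \<and> digit (val (w @ [b])) = of_bool b"
  proof (cases "rep (val (w @ [b])) = []")
    case True
    then have *: "w @ [b] = replicate j False" using j by simp
    then have "val (w @ [b]) = 0" using val_leading_zeros[of j "[]"] by simp
    moreover have "val w = 0" using * val_leading_zeros[of "j - 1" "[]"]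
      by (metis append_Nil2 butlast_snoc length_replicate length_butlast replicate_append_same replicate_length_same in_set_replicate in_set_butlastD val.simps(1))
    moreover have "\<not> b" using * by (metis in_set_replicate last_in_set last_snoc snoc_eq_iff_butlast)
    ultimately show ?thesis by (simp add: parent_def digit_def rep_def)
  next
    case False
    then have "w = replicate j False @ butlast (rep (val (w @ [b])))"
      "b = last (rep (val (w @ [b])))"
      using j by (metis butlast_append butlast_snoc) (metis j False last_appendR last_snoc)
    moreover have "val (w @ [b]) \<noteq> 0" using False by (metis rep_def)
    ultimately show ?thesis
      unfolding parent_def digit_def using val_leading_zeros by metis
  qed
  then show "parent (val (w @ [b])) = val w" "digit (val (w @ [b])) = of_bool b" by auto
qed

lemma child:
  assumes "b < length (psi (state m))"
  shows "parent (first_child m + b) = m" "digit (first_child m + b) = b"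
    "state (first_child m + b) = psi (state m) ! b"
proof -
  obtain w where w: "path (N S) w = Some (state m)" "val w = m" using ex_word[OF U_ge] by metis
  have "b = 0 \<or> b = 1" using assms length_psi[of "state m"] by auto
  then have b: "b = of_bool (b = 1)" by auto
  then have p: "path (N S) (w @ [b = 1]) = Some (psi (state m) ! b)"
    using assms by (simp add: path_append w step_def)
  then show "parent (first_child m + b) = m" "digit (first_child m + b) = b"
    "state (first_child m + b) = psi (state m) ! b"
    using child_val[OF p] parent_val[OF p] state_val[OF p] b w(2) by metis+
qed

lemma parent_decomp: "n = first_child (parent n) + digit n" "digit n < length (psi (state (parent n)))"
proof -
  obtain v where v: "path (N S) v = Some (state n)" "val v = n" "length v = Suc n"
    using ex_word[of n "Suc n"] U_ge[of n] U_less_Suc[of n] by (metis less_trans)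
  then obtain w b where wb: "v = w @ [b]" by (cases v rule: rev_cases) auto
  note p = v(1)[unfolded wb]
  obtain t where t: "path (N S) w = Some t" "step t b = Some (state n)"
    using p by (auto simp: path_append split: option.splits)
  show "n = first_child (parent n) + digit n" 
    using child_val[OF p] parent_val[OF p] v wb by simp
  have "of_bool b < length (psi t)" using t(2) by (rule_tac ccontr) (simp add: step_def)
  then show "digit n < length (psi (state (parent n)))"
    using parent_val[OF p] state_val[OF t(1)] v wb by simp
qed

section \<open>Windows of three consecutive states\<close>

text \<open>The pairs of states of \<open>n + 1\<close> and \<open>n + 2\<close> that occur when \<open>n\<close> has the given state.\<close>

primrec follow :: "letter \<Rightarrow> (node \<times> node) list" where
  "follow S = [(N Q1, N Q2)]"
| "follow Q1 = [(N Q2, N Q3), (N Q2, N Q5), (N Q2, N Q7), (N Q2, N Q9), (N Q2, N Q18),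
    (N Q5, N Q12), (N Q7, N Q8), (N Q9, N Q10), (N Q15, N Q16)]"
| "follow Q2 = [(N Q3, N Q4), (N Q3, N Q5), (N Q3, N Q7), (N Q3, N Q9), (N Q3, N Q22),
    (N Q5, N Q12), (N Q7, N Q8), (N Q9, N Q10), (N Q18, N Q19)]"
| "follow Q3 = [(N Q4, N Q5), (N Q4, N Q7), (N Q4, N Q9), (N Q5, N Q12), (N Q7, N Q8),
    (N Q9, N Q10), (N Q22, N Q23)]"
| "follow Q4 = [(N Q5, X6), (N Q5, N Q12), (N Q7, N Q8), (N Q9, N Q10), (N Q9, X28)]"
| "follow Q5 = [(X6, N Q5), (X6, N Q7), (X6, N Q9), (N Q12, N Q13), (N Q12, N Q20)]"
| "follow Q7 = [(N Q8, N Q5), (N Q8, N Q7), (N Q8, N Q9), (N Q8, N Q15)]"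
| "follow Q8 = [(N Q2, N Q3), (N Q5, N Q12), (N Q7, N Q8), (N Q9, N Q10), (N Q15, N Q16),
    (N Q15, N Q24)]"
| "follow Q9 = [(N Q10, N Q11), (X28, N Q25)]"
| "follow Q10 = [(N Q11, N Q3), (N Q11, N Q5), (N Q11, N Q7), (N Q11, N Q9), (N Q11, N Q18),
    (N Q26, N Q1)]"
| "follow Q11 = [(N Q3, N Q4), (N Q5, N Q12), (N Q7, N Q8), (N Q9, N Q10), (N Q18, N Q19),
    (N Q18, N Q26)]"
| "follow Q12 = [(N Q13, N Q14), (N Q20, N Q27)]"
| "follow Q13 = [(N Q14, N Q4), (N Q14, N Q5), (N Q14, N Q7), (N Q14, N Q9), (N Q14, N Q22),
    (N Q23, N Q8)]"
| "follow Q14 = [(N Q4, N Q5), (N Q5, N Q12), (N Q7, N Q8), (N Q9, N Q10), (N Q22, N Q23)]"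
| "follow Q15 = [(N Q16, N Q17), (N Q16, N Q25), (N Q24, N Q1)]"
| "follow Q16 = [(N Q17, N Q5), (N Q17, N Q7), (N Q17, N Q9), (N Q25, N Q10)]"
| "follow Q17 = [(N Q5, X6), (N Q5, N Q12), (N Q7, N Q8), (N Q9, N Q10), (N Q9, X28)]"
| "follow Q18 = [(N Q19, N Q20), (N Q26, N Q1)]"
| "follow Q19 = [(N Q20, X21), (N Q20, N Q27)]"
| "follow Q20 = [(X21, N Q5), (X21, N Q7), (X21, N Q9), (N Q27, N Q13)]"
| "follow Q22 = [(N Q23, N Q8), (N Q23, X21)]"
| "follow Q23 = [(N Q8, N Q2), (X21, N Q24)]"
| "follow Q24 = [(N Q1, N Q5), (N Q1, N Q7), (N Q1, N Q9), (N Q1, N Q15)]"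
| "follow Q25 = [(N Q10, N Q11), (N Q10, N Q26)]"
| "follow Q26 = [(N Q1, N Q2)]"
| "follow Q27 = [(N Q13, N Q14), (N Q13, N Q23)]"

text \<open>Used with \<open>f\<close> an iterate of \<open>parent\<close>: a stretch of consecutive
  numbers is recorded by states and by how far their ancestors lie from a base \<open>g\<close>.
  Applying \<open>below\<close> moves the stretch down one level while the base stays fixed.\<close>

definition labels :: "(nat \<Rightarrow> nat) \<Rightarrow> nat \<Rightarrow> nat \<Rightarrow> (nat \<times> node) list \<Rightarrow> bool" where
  "labels f g n l \<longleftrightarrow> (\<forall>i<length l. f (n + i) = g + fst (l ! i) \<and> state (n + i) = snd (l ! i))"

definition below :: "(nat \<times> node) list \<Rightarrow> (nat \<times> node) list" where
  "below l = concat (map (\<lambda>(i, q). map (Pair i) (psi q)) l)"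

lemma labels_Cons: "labels f g n ((i, q) # l) \<longleftrightarrow> f n = g + i \<and> state n = q \<and> labels f g (Suc n) l"
  unfolding labels_def by (auto simp: nth_Cons' All_less_Suc2 less_Suc_eq_0_disj)

lemma labels_append: "labels f g n (l @ l') \<longleftrightarrow> labels f g n l \<and> labels f g (n + length l) l'"
  by (induction l arbitrary: n) (auto simp: labels_Cons, simp_all add: labels_def)

lemma labels_below: "labels f g m l \<Longrightarrow> labels (f \<circ> parent) g (first_child m) (below l)"
proof (induction l arbitrary: m)
  case (Cons p l)
  obtain i q where p: "p = (i, q)" by fastforce
  have "labels (f \<circ> parent) g (first_child m) (map (Pair i) (psi q))"
    using Cons.prems child[of _ m] unfolding p labels_Cons labels_def by auto
  moreover have "first_child (Suc m) = first_child m + length (psi q)"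
    using Cons.prems unfolding p labels_Cons by (simp add: first_child_Suc)
  ultimately show ?case
    using Cons.IH[of "Suc m"] Cons.prems unfolding p labels_Cons by (auto simp: below_def labels_append o_def)
qed (simp add: below_def labels_def)

lemma labels_drop: "labels f g n l \<Longrightarrow> b \<le> length l \<Longrightarrow> labels f g (n + b) (drop b l)"
  by (auto simp: labels_def add.assoc)

lemma labels_child:
  assumes "labels f g (parent n) l" "l \<noteq> []"
  shows "labels (f \<circ> parent) g n (drop (digit n) (below l))"
proof -
  have "digit n \<le> length (below l)"
    using parent_decomp(2)[of n] assms by (cases l) (auto simp: below_def labels_Cons)
  then show ?thesis using labels_drop[OF labels_below[OF assms(1)]] parent_decomp(1)[of n] by metis
qed

definition window :: "letter \<Rightarrow> node \<times> node \<Rightarrow> (nat \<times> node) list" where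
  "window x p = [(0, N x), (1, fst p), (2, snd p)]"

text \<open>Closure of the triples under passing to a child. A leaf has no descendants and needs no
  triple. The last case also catches a letter followed by fewer than two nodes, and is then false
  because letters have children.\<close>

definition check_follow :: "letter \<Rightarrow> node \<times> node \<Rightarrow> bool" where
  "check_follow x p = list_all (\<lambda>b. case map snd (drop b (below (window x p))) of
       N y # r # r' # _ \<Rightarrow> (r, r') \<in> set (follow y) | [] \<Rightarrow> False | q # _ \<Rightarrow> psi q = [])
     [0..<length (children x)]"

lemma check_follow: "p \<in> set (follow x) \<Longrightarrow> check_follow x p"
proof -
  have "list_all (check_follow x) (follow x)"
    by (cases x; hypsubst; code_simp)
  then show "p \<in> set (follow x) \<Longrightarrow> check_follow x p" by (simp add: list_all_iff)
qed

lemma labels_state: "labels f g n l \<Longrightarrow> i < length l \<Longrightarrow> state (n + i) = map snd l ! i"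
  by (simp add: labels_def)

lemma state_0: "state 0 = N S" and state_1: "state 1 = N Q1" and state_2: "state 2 = N Q2"
  using state_val[of "[]" "N S"] state_val[of "[True]" "N Q1"]
    state_val[of "[True, False]" "N Q2"] by (simp_all add: step_def)

lemma val_snoc: "val w \<le> val (w @ [b])" "val w \<noteq> 0 \<Longrightarrow> val w < val (w @ [b])"
proof -
  have "val w \<le> val (w @ [b]) \<and> (val w \<noteq> 0 \<longrightarrow> val w < val (w @ [b]))"
  proof (induction w)
    case (Cons c w)
    then show ?case using U_less_Suc[of "length w"] by (cases c) auto
  qed simp
  then show "val w \<le> val (w @ [b])" "val w \<noteq> 0 \<Longrightarrow> val w < val (w @ [b])" by auto
qed

lemma parent_less: assumes "n \<noteq> 0" shows "parent n < n"
proof -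
  have "rep n \<noteq> []" using assms val_rep[of n] by auto
  then obtain w b where "rep n = w @ [b]" by (cases "rep n" rule: rev_cases) auto
  then show ?thesis using val_snoc[of w b] val_rep[of n] assms by (cases "val w = 0") (auto simp: parent_def)
qed

lemma parent_0 [simp]: "parent 0 = 0"
  by (simp add: parent_def rep_def)

lemma parent_inner: obtains x where "state (parent n) = N x" "digit n < length (children x)"
  using parent_decomp(2)[of n] by (cases "state (parent n)") auto

lemma children_nonempty: "children x \<noteq> []"
  by (cases x) simp_all

lemma window_exists: "state n = N x \<Longrightarrow> \<exists>p\<in>set (follow x). labels id n n (window x p)"
proof (induction n arbitrary: x rule: less_induct)
  case (less n)
  show ?case
  \<comment> \<open>0 is its own parent and starts the induction; every other number has a smaller
    parent.\<close>
  proof (cases "n = 0")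
    case True
    with less.prems have "x = S" by (simp add: state_0)
    then show ?thesis using True state_0 state_1 state_2
      by (simp add: window_def labels_Cons numeral_eq_Suc) (simp add: labels_def)
  next
    case False
    obtain y where y: "state (parent n) = N y" "digit n < length (children y)"
      using parent_inner by blast
    obtain p where p: "p \<in> set (follow y)" "labels id (parent n) (parent n) (window y p)"
      using less.IH[OF parent_less[OF False] y(1)] by blast
    let ?l = "drop (digit n) (below (window y p))"
    have l: "labels (id \<circ> parent) (parent n) n ?l"
      using labels_child[OF p(2)] by (simp add: window_def)
    have c: "case map snd ?l of N y # r # r' # _ \<Rightarrow> (r, r') \<in> set (follow y) | [] \<Rightarrow> False
        | q # _ \<Rightarrow> psi q = []"
      using check_follow[OF p(1)] y(2) unfolding check_follow_def list_all_iff by auto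
    have "?l \<noteq> []" using c by auto
    then have "hd (map snd ?l) = N x" using labels_state[OF l, of 0] less.prems by (cases ?l) auto
    with c obtain r r' u where u: "map snd ?l = N x # r # r' # u" "(r, r') \<in> set (follow x)"
      using children_nonempty[of x] by (auto split: list.splits node.splits)
    then have "length ?l = Suc (Suc (Suc (length u)))" by (metis length_map length_Cons)
    then have "state (n + 1) = r" "state (n + 2) = r'"
      using labels_state[OF l, of 1] labels_state[OF l, of 2] u(1) by auto
    then show ?thesis
      using u(2) less.prems by (intro bexI[of _ "(r, r')"]) (auto simp: window_def labels_def less_Suc_eq)
  qed
qed

lemma ancestor_window: obtains x p where "state (parent n) = N x" "p \<in> set (follow x)"
    "labels id (parent n) (parent n) (window x p)" "digit n < length (children x)"
  using parent_inner window_exists by metis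


section \<open>The candidate solution and its differences\<close>

text \<open>The candidate is a grandparent plus a correction, so consecutive values are compared two
  levels below a window: \<open>i'\<close> is the amount by which the grandparent advances from a
  number to its successor.\<close>

definition check_diff :: "letter \<Rightarrow> node \<times> node \<Rightarrow> bool" where
  "check_diff x p = list_all (\<lambda>b. let l = drop b (below (window x p)) in
     list_all (\<lambda>b'. case drop b' (below l) of
         (i, q) # (i', q') # _ \<Rightarrow> i = 0 \<and> int i' + E_of q' = E_of q + D_of q
       | _ \<Rightarrow> False) [0..<length (psi (snd (hd l)))]) [0..<length (children x)]"

lemma check_diff: "p \<in> set (follow x) \<Longrightarrow> check_diff x p"
proof -
  have "list_all (check_diff x) (follow x)"
    by (cases x; hypsubst; code_simp)
  then show "p \<in> set (follow x) \<Longrightarrow> check_diff x p" by (simp add: list_all_iff)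
qed

definition sol :: "nat \<Rightarrow> nat" where
  "sol n = nat (int (parent (parent n)) + E_of (state n))"

lemma sol_diff: "int (parent (parent (Suc n))) + E_of (state (Suc n)) =
    int (parent (parent n)) + E_of (state n) + D_of (state n)"
proof -
  obtain x p where xp: "state (parent (parent n)) = N x" "p \<in> set (follow x)"
    "labels id (parent (parent n)) (parent (parent n)) (window x p)"
    "digit (parent n) < length (children x)" using ancestor_window by blast
  let ?l = "drop (digit (parent n)) (below (window x p))"
  have l: "labels (id \<circ> parent) (parent (parent n)) (parent n) ?l"
    using labels_child[OF xp(3)] by (simp add: window_def)
  have "?l \<noteq> []" using xp(4) by (simp add: window_def below_def)
  then have hd: "snd (hd ?l) = state (parent n)" 
    using labels_state[OF l, of 0] by (cases ?l) auto
  have l': "labels (id \<circ> parent \<circ> parent) (parent (parent n)) n (drop (digit n) (below ?l))"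
    by (rule labels_child[OF l \<open>?l \<noteq> []\<close>])
  have "case drop (digit n) (below ?l) of
         (i, q) # (i', q') # _ \<Rightarrow> i = 0 \<and> int i' + E_of q' = E_of q + D_of q | _ \<Rightarrow> False"
    using check_diff[OF xp(2)] parent_decomp(2)[of n] xp(4) hd
    unfolding check_diff_def list_all_iff Let_def by auto
  then obtain i q i' q' u where "drop (digit n) (below ?l) = (i, q) # (i', q') # u"
    "i = 0" "int i' + E_of q' = E_of q + D_of q"
    by (auto split: list.splits) (metis list.exhaust surj_pair)
  with l' show ?thesis by (simp add: labels_Cons)
qed

lemma D_of_range: "D_of q \<in> {0, 1}"
  by (cases q; simp; rename_tac x; case_tac x) simp_all

text \<open>The truncation in \<open>sol\<close> never takes effect: the integer value is 0 at 0 and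
  grows by 0 or 1 in each step.\<close>

lemma int_sol: "int (sol n) = int (parent (parent n)) + E_of (state n)"
proof -
  have "0 \<le> int (parent (parent n)) + E_of (state n)"
  proof (induction n)
    case (Suc n)
    then show ?case using sol_diff[of n] D_of_range[of "state n"] by auto
  qed (simp add: state_0)
  then show ?thesis by (simp add: sol_def)
qed

lemma sol_Suc: "int (sol (Suc n)) = int (sol n) + D_of (state n)"
  using sol_diff[of n] by (simp add: int_sol)

text \<open>The offset is an integer because \<open>rec_ok\<close> obtains it by a subtraction whose
  sign is only checked there.\<close>

definition sum_D :: "(nat \<times> node) list \<Rightarrow> int \<Rightarrow> int" where
  "sum_D l e = (\<Sum>q\<leftarrow>take (nat e) l. D_of (snd q))"

lemma sol_add: "labels f g n l \<Longrightarrow> e \<le> length l \<Longrightarrow> int (sol (n + e)) = int (sol n) + sum_D l (int e)"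
proof (induction l arbitrary: n e)
  case (Cons p l)
  then show ?case
    using sol_Suc[of n] Cons.IH[of "Suc n" "e - 1"] by (cases e; cases p) (auto simp: sum_D_def labels_Cons nat_add_distrib)
qed (simp add: sum_D_def)

section \<open>Ages, digit identities and the nested recurrence\<close>

lemma step_age:
  assumes "step q b = Some (N t)"
  shows "\<exists>x. q = N x \<and> (if b then age x = 0 \<and> age t = 1 else
      age t = (if age x = 0 \<or> age x = 4 then 0 else Suc (age x)))"
proof (cases q)
  case (N x)
  then show ?thesis using assms by (cases x; cases b) (auto simp: step_def)
qed (use assms in \<open>simp_all add: step_def\<close>)

lemma age_le: "age x \<le> 4"
  by (cases x) simp_all

lemma path_snoc: "path q (w @ [b]) = Some r \<longleftrightarrow> (\<exists>t. path q w = Some t \<and> step t b = Some r)"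
  by (auto simp: path_append split: option.splits)

text \<open>The identities below involve three digits above those seen in the window. At most one of
  them is 1, and the age alone determines the two combinations that are needed.\<close>

lemma path_age:
  assumes "path (N S) (w @ [b2, b1, b0]) = Some (N x)"
  shows "of_bool b0 = (of_bool (age x = 1) :: nat)"
    "of_bool b0 + of_bool b1 + of_bool b2 = (of_bool (age x \<in> {1, 2, 3}) :: nat)"
proof -
  have "path (N S) (((w @ [b2]) @ [b1]) @ [b0]) = Some (N x)" using assms by simp
  then obtain t u v where s: "step t b0 = Some (N x)" "step u b1 = Some t" "step v b2 = Some u"
    unfolding path_snoc by blast
  from step_age[OF s(1)] obtain y where y: "t = N y"
    "if b0 then age y = 0 \<and> age x = 1 else age x = (if age y = 0 \<or> age y = 4 then 0 else Suc (age y))"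
    by blast
  from step_age[OF s(2)[unfolded y]] obtain z where z: "u = N z"
    "if b1 then age z = 0 \<and> age y = 1 else age y = (if age z = 0 \<or> age z = 4 then 0 else Suc (age z))"
    by blast
  from step_age[OF s(3)[unfolded z]] obtain r where r:
    "if b2 then age r = 0 \<and> age z = 1 else age z = (if age r = 0 \<or> age r = 4 then 0 else Suc (age r))"
    by blast
  show "of_bool b0 = (of_bool (age x = 1) :: nat)"
    "of_bool b0 + of_bool b1 + of_bool b2 = (of_bool (age x \<in> {1, 2, 3}) :: nat)"
    using y(2) z(2) r age_le[of r] by (simp_all split: if_splits)
qed

text \<open>Digitwise forms of \<open>t ^ 5 = t ^ 4 + 1\<close> and \<open>t ^ 3 = t + 1\<close>:
  deleting \<open>j\<close> digits replaces \<open>U p\<close> by \<open>U (p - j)\<close>. The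
  \<open>of_bool\<close> terms repair the lowest positions, where the recurrences of the weights
  fail or reach below position 0.\<close>

lemma val_identities:
  "val (v @ [d5, d4, d3, d2, d1, d0]) = val (v @ [d5, d4, d3, d2, d1]) + val (v @ [d5])
    + of_bool d0 + of_bool d1 + of_bool d2 + of_bool d3 + of_bool d4 + of_bool d5"
  "val (v @ [d5, d4, d3, d2, d1, d0]) = val (v @ [d5, d4, d3, d2]) + val (v @ [d5, d4, d3])
    + of_bool d0 + 2 * of_bool d1 + 2 * of_bool d2 + of_bool d3"
proof (induction v)
  case (Cons b v)
  {
    case 1
    show ?case using Cons.IH(1) U_growth[of "Suc (length v)"] by (simp add: numeral_eq_Suc)
  next
    case 2
    show ?case using Cons.IH(2) by (simp add: numeral_eq_Suc)
  }
qed (simp_all add: numeral_eq_Suc)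

text \<open>
  Here \<open>q\<close> and \<open>q1\<close> are the states of \<open>n\<close> and its parent, \<open>x\<close> is the state of its third ancestor, and
  \<open>b0\<close>, \<open>b1\<close>, \<open>b2\<close> are the last digits of \<open>n\<close>. The arguments in the recurrence exceed the third and the
  first ancestor by \<open>e3\<close> and \<open>e1\<close>; the digits above \<open>b2\<close> that matter are recovered from the age of \<open>x\<close>.
\<close>

definition rec_ok :: "letter \<Rightarrow> (nat \<times> node) list \<Rightarrow> (nat \<times> node) list \<Rightarrow> nat \<Rightarrow> nat \<Rightarrow> nat \<Rightarrow> node \<Rightarrow> node \<Rightarrow> bool"
  where "rec_ok x l3 l1 b2 b1 b0 q1 q = (let
         k = int (b0 + 2 * b1 + 2 * b2 + of_bool (age x = 1)) + 1;
         e3 = k - E_of q;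
         e1 = int (b0 + b1 + b2 + of_bool (age x \<in> {1, 2, 3})) + 1 - letter_e x - sum_D l3 e3
       in 0 \<le> e3 \<and> e3 \<le> 3 \<and> 0 \<le> e1 \<and> e1 \<le> int (length l1) \<and>
          E_of q + D_of q + E_of q1 + sum_D l1 e1 = k)"

definition check_rec :: "letter \<Rightarrow> node \<times> node \<Rightarrow> bool" where
  "check_rec x p = list_all (\<lambda>b2. let l2 = drop b2 (below (window x p)) in
     list_all (\<lambda>b1. let l1 = drop b1 (below l2) in l1 \<noteq> [] \<and>
     list_all (\<lambda>b0. rec_ok x (window x p) l1 b2 b1 b0 (snd (hd l1)) (psi (snd (hd l1)) ! b0))
     [0..<length (psi (snd (hd l1)))]) [0..<length (psi (snd (hd l2)))]) [0..<length (children x)]"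

lemma check_rec: "p \<in> set (follow x) \<Longrightarrow> check_rec x p"
proof -
  have "list_all (check_rec x) (follow x)"
    by (cases x; hypsubst; code_simp)
  then show "p \<in> set (follow x) \<Longrightarrow> check_rec x p" by (simp add: list_all_iff)
qed

text \<open>Let \<open>n1\<close>, \<open>n2\<close>, ..., \<open>n5\<close> be the successive
  ancestors of \<open>n\<close>. Up to small terms, \<open>val_identities\<close> reads
  \<open>n = n1 + n5\<close> and \<open>n = n2 + n3\<close>. So \<open>n + 1 - sol n\<close> is near
  \<open>n3\<close>, its image is near \<open>n5\<close>, the next argument is near
  \<open>n1\<close>, its image is near \<open>n3\<close>, and \<open>sol (n + 1)\<close>, near
  \<open>n2\<close>, completes the sum. That the small terms match is \<open>rec_ok\<close>.\<close>

lemma sol_rec: "sol n \<le> n + 1" "sol (n + 1 - sol n) \<le> n + 1"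
  "sol (n + 1) + sol (n + 1 - sol (n + 1 - sol n)) = n + 1"
proof -
  define n1 where "n1 = parent n"
  define n2 where "n2 = parent n1"
  define n3 where "n3 = parent n2"
  obtain x p where xp: "state n3 = N x" "p \<in> set (follow x)" "labels id n3 n3 (window x p)"
    "digit n2 < length (children x)" unfolding n3_def using ancestor_window by blast
  \<comment> \<open>The padding provides the six digits of \<open>val_identities\<close> also for
    small \<open>n\<close>.\<close>
  obtain w0 where w0: "length w0 = n + 7" "path (N S) w0 = Some (state n)" "val w0 = n"
    using ex_word[of n "n + 7"] U_ge[of "n + 7"] by auto
  have ex_last: "\<exists>v b. w = v @ [b] \<and> length v = k" if "length w = Suc k" for w :: "bool list" and k
    using that by (cases w rule: rev_cases) auto
  obtain w1 d0 where w1: "w0 = w1 @ [d0]" "length w1 = n + 6"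
    using ex_last[of w0 "n + 6"] w0(1) by auto
  obtain w2 d1 where w2: "w1 = w2 @ [d1]" "length w2 = n + 5"
    using ex_last[of w1 "n + 5"] w1(2) by auto
  obtain w3 d2 where w3: "w2 = w3 @ [d2]" "length w3 = n + 4"
    using ex_last[of w2 "n + 4"] w2(2) by auto
  obtain w4 d3 where w4: "w3 = w4 @ [d3]" "length w4 = n + 3"
    using ex_last[of w3 "n + 3"] w3(2) by auto
  obtain w5 d4 where w5: "w4 = w5 @ [d4]" "length w5 = n + 2"
    using ex_last[of w4 "n + 2"] w4(2) by auto
  obtain v d5 where w6: "w5 = v @ [d5]" "length v = n + 1"
    using ex_last[of w5 "n + 1"] w5(2) by auto
  have w: "w0 = v @ [d5, d4, d3, d2, d1, d0]" by (simp add: w1 w2 w3 w4 w5 w6)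
  note p0 = w0(2)[unfolded w]
  obtain t1 where p1: "path (N S) (v @ [d5, d4, d3, d2, d1]) = Some t1" "step t1 d0 = Some (state n)"
    using p0 path_snoc[of "N S" "v @ [d5, d4, d3, d2, d1]" d0 "state n"] by auto
  obtain t2 where p2: "path (N S) (v @ [d5, d4, d3, d2]) = Some t2" "step t2 d1 = Some (t1)"
    using p1(1) path_snoc[of "N S" "v @ [d5, d4, d3, d2]" d1 "t1"] by auto
  obtain t3 where p3: "path (N S) (v @ [d5, d4, d3]) = Some t3" "step t3 d2 = Some (t2)"
    using p2(1) path_snoc[of "N S" "v @ [d5, d4, d3]" d2 "t2"] by auto
  obtain t4 where p4: "path (N S) (v @ [d5, d4]) = Some t4" "step t4 d3 = Some (t3)"
    using p3(1) path_snoc[of "N S" "v @ [d5, d4]" d3 "t3"] by auto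
  obtain t5 where p5: "path (N S) (v @ [d5]) = Some t5" "step t5 d4 = Some (t4)"
    using p4(1) path_snoc[of "N S" "v @ [d5]" d4 "t4"] by auto
  have n: "val (v @ [d5, d4, d3, d2, d1, d0]) = n" using w0 w by simp
  have n1: "val (v @ [d5, d4, d3, d2, d1]) = n1" "digit n = of_bool d0"
    using parent_val[of "v @ [d5, d4, d3, d2, d1]" d0] p0 n by (auto simp: n1_def)
  have n2: "val (v @ [d5, d4, d3, d2]) = n2" "digit n1 = of_bool d1"
    using parent_val[of "v @ [d5, d4, d3, d2]" d1] p1 n1 by (auto simp: n2_def)
  have n3: "val (v @ [d5, d4, d3]) = n3" "digit n2 = of_bool d2"
    using parent_val[of "v @ [d5, d4, d3]" d2] p2 n2 by (auto simp: n3_def)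
  have n4: "val (v @ [d5, d4]) = parent n3"
    using parent_val[of "v @ [d5, d4]" d3] p3 n3 by auto
  have n5: "val (v @ [d5]) = parent (parent n3)"
    using parent_val[of "v @ [d5]" d4] p4 n4 by auto
  have s3: "t3 = N x" using state_val[OF p3(1)] n3 xp by simp
  have age: "of_bool (age x = 1) = (of_bool d3 :: nat)"
    "of_bool (age x \<in> {1, 2, 3}) = (of_bool d3 + of_bool d4 + of_bool d5 :: nat)"
    using path_age[of v d5 d4 d3 x] p3(1) s3 by simp_all
  let ?l2 = "drop (digit n2) (below (window x p))"
  have l2: "labels (id \<circ> parent) n3 n2 ?l2"
    using labels_child[of id n3 n2 "window x p"] xp(3) by (simp add: window_def n3_def)
  have "?l2 \<noteq> []" using xp(4) by (simp add: window_def below_def)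
  then have hd2: "snd (hd ?l2) = state n2" using labels_state[OF l2, of 0] by (cases ?l2) auto
  let ?l1 = "drop (digit n1) (below ?l2)"
  have l1: "labels (id \<circ> parent \<circ> parent) n3 n1 ?l1"
    using labels_child[of "id \<circ> parent" n3 n1 ?l2] l2 \<open>?l2 \<noteq> []\<close> by (simp add: n2_def)
  have dig: "digit n1 < length (psi (state n2))" "digit n < length (psi (state n1))"
    using parent_decomp(2) by (simp_all add: n1_def n2_def)
  have c1: "?l1 \<noteq> [] \<and> list_all (\<lambda>b0. rec_ok x (window x p) ?l1 (digit n2) (digit n1) b0
      (snd (hd ?l1)) (psi (snd (hd ?l1)) ! b0)) [0..<length (psi (snd (hd ?l1)))]"
    using check_rec[OF xp(2)] xp(4) dig(1)
    unfolding check_rec_def Let_def list_all_iff hd2[symmetric] by auto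
  then have hd1: "snd (hd ?l1) = state n1" using labels_state[OF l1, of 0] by (cases ?l1) auto
  have q: "psi (state n1) ! digit n = state n"
    using child(3)[OF dig(2)] parent_decomp(1)[of n] by (simp add: n1_def)
  have ok: "rec_ok x (window x p) ?l1 (digit n2) (digit n1) (digit n) (state n1) (state n)"
    using c1 dig(2) q unfolding list_all_iff hd1 by (metis atLeastLessThan_iff le0 set_upt)
  define k where "k = int (digit n + 2 * digit n1 + 2 * digit n2 + of_bool (age x = 1)) + 1"
  define e3 where "e3 = k - E_of (state n)"
  define e1 where "e1 = int (digit n + digit n1 + digit n2 + of_bool (age x \<in> {1, 2, 3})) + 1
    - letter_e x - sum_D (window x p) e3"
  have e: "0 \<le> e3" "e3 \<le> 3" "0 \<le> e1" "e1 \<le> int (length ?l1)"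
    "E_of (state n) + D_of (state n) + E_of (state n1) + sum_D ?l1 e1 = k"
    using ok unfolding rec_ok_def Let_def k_def e3_def e1_def by blast+
  have id1: "int n = int n1 + int (parent (parent n3)) + int (digit n + digit n1 + digit n2
      + of_bool (age x \<in> {1, 2, 3}))"
    using val_identities(1)[of v d5 d4 d3 d2 d1 d0] unfolding age n n1 n2 n3 n5 by simp
  have id2: "int n + 1 = int n2 + int n3 + k"
    using val_identities(2)[of v d5 d4 d3 d2 d1 d0] unfolding k_def age n n1 n2 n3 n5 by simp
  have "int n + 1 - int (sol n) = int n3 + e3"
    using id2 int_sol[of n] unfolding e3_def by (simp add: n1_def n2_def)
  then have le1: "sol n \<le> n + 1" and X: "n + 1 - sol n = n3 + nat e3" using e(1) by simp_all
  have "int (sol (n + 1 - sol n)) = int (sol n3) + sum_D (window x p) (int (nat e3))"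
    unfolding X by (rule sol_add[OF xp(3)]) (use e in \<open>simp add: window_def\<close>)
  then have "int n + 1 - int (sol (n + 1 - sol n)) = int n1 + e1"
    using id1 int_sol[of n3] xp(1) e(1) unfolding e1_def by simp
  then have le2: "sol (n + 1 - sol n) \<le> n + 1"
    and Y: "n + 1 - sol (n + 1 - sol n) = n1 + nat e1" using e(3) by simp_all
  have "int (sol (n + 1 - sol (n + 1 - sol n))) = int (sol n1) + sum_D ?l1 (int (nat e1))"
    unfolding Y by (rule sol_add[OF l1]) (use e in simp)
  then have "sol (n + 1) + sol (n + 1 - sol (n + 1 - sol n)) = n + 1"
    using e(3,5) id2 int_sol[of n1] int_sol[of n] sol_Suc[of n]
    by (simp add: n1_def n2_def n3_def)
  with le1 le2 show "sol n \<le> n + 1" "sol (n + 1 - sol n) \<le> n + 1"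
    "sol (n + 1) + sol (n + 1 - sol (n + 1 - sol n)) = n + 1" by blast+
qed

lemma sol_0: "sol 0 = 0" and sol_1: "sol 1 = 1"
  using int_sol[of 0] sol_Suc[of 0] by (simp_all add: state_0)

lemma sol_le_Suc: "sol n \<le> sol (Suc n)" "sol (Suc n) \<le> Suc (sol n)"
  using sol_Suc[of n] D_of_range[of "state n"] by auto

lemma sol_mono: "m \<le> n \<Longrightarrow> sol m \<le> sol n"
  by (rule lift_Suc_mono_le[of sol]) (rule sol_le_Suc)

lemma sol_le: "sol n \<le> n"
  by (induction n) (auto simp: sol_0 intro: order_trans[OF sol_le_Suc(2)])

lemma sol_pos: "n \<noteq> 0 \<Longrightarrow> 0 < sol n"
  using sol_mono[of 1 n] sol_1 by simp

lemma nested_recurrence_sol: "nested_recurrence sol"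
proof -
  have "sol (n - 1) \<le> n \<and> sol (n - sol (n - 1)) \<le> n \<and>
      int (sol n) = int n - int (sol (n - sol (n - sol (n - 1))))" if "n \<ge> 2" for n
    using sol_rec[of "n - 1"] that by auto
  then show ?thesis using sol_1 by (auto simp: nested_recurrence_def sol_0)
qed

text \<open>Since \<open>sol\<close> is positive at positive arguments, all inner arguments are
  smaller than \<open>n\<close>, and the recurrence determines the value at \<open>n\<close> from
  earlier ones.\<close>

lemma nested_recurrence_unique:
  assumes "nested_recurrence a"
  shows "a = sol"
proof
  fix n
  show "a n = sol n"
  proof (induction n rule: less_induct)
    case (less n)
    show ?case
    proof (cases "n \<ge> 2")
      case False
      then have "n = 0 \<or> n = 1" by auto
      then show ?thesis using assms sol_1 by (auto simp: nested_recurrence_def sol_0)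
    next
      case True
      have rec: "int (f n) = int n - int (f (n - f (n - f (n - 1))))" if "nested_recurrence f" for f
        using that True by (simp add: nested_recurrence_def)
      have p1: "0 < sol (n - 1)" "sol (n - 1) \<le> n - 1" using sol_pos sol_le True by simp_all
      then have p2: "0 < sol (n - sol (n - 1))" using sol_pos True by simp
      have "a (n - 1) = sol (n - 1)" "a (n - sol (n - 1)) = sol (n - sol (n - 1))"
        "a (n - sol (n - sol (n - 1))) = sol (n - sol (n - sol (n - 1)))"
        using p1 p2 True by (intro less.IH; simp)+
      then show ?thesis using rec[OF assms] rec[OF nested_recurrence_sol] by simp
    qed
  qed
qed

section \<open>The shift as the grandparent\<close>

lemma sum_ones: "(\<Sum>p | p \<in> ones w \<and> j \<le> p. U (p - j)) = val (take (length w - j) w)"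
proof (induction w)
  case (Cons b w)
  have f: "finite {p \<in> ones w. j \<le> p}"
    by (rule finite_subset[of _ "{..<length w}"]) (auto dest: ones_less)
  have "{p \<in> ones (b # w). j \<le> p} =
      (if b \<and> j \<le> length w then insert (length w) else id) {p \<in> ones w. j \<le> p}"
    by auto
  moreover have "length w \<notin> {p \<in> ones w. j \<le> p}" using ones_less by blast
  ultimately have "(\<Sum>p | p \<in> ones (b # w) \<and> j \<le> p. U (p - j)) =
      of_bool (b \<and> j \<le> length w) * U (length w - j) + (\<Sum>p | p \<in> ones w \<and> j \<le> p. U (p - j))"
    using f sum.insert[of "{p \<in> ones w. j \<le> p}" "length w" "\<lambda>p. U (p - j)"]
    by (cases "b \<and> j \<le> length w") (simp_all only: if_True if_False id_apply of_bool_eq, simp_all)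
  then show ?case unfolding Cons.IH by (cases "j \<le> length w") (auto simp: Suc_diff_le)
qed simp

lemma shift2_val: "path (N S) w = Some r \<Longrightarrow> shift2 (val w) = val (take (length w - 2) w)"
  unfolding shift2_def greedy_val by (rule sum_ones)

lemma take_append2: "length w = Suc (Suc k) \<Longrightarrow> \<exists>b c. w = take k w @ [b, c]"
proof -
  assume "length w = Suc (Suc k)"
  then have "length (drop k w) = Suc (Suc 0)" by simp
  then obtain b c where "drop k w = [b, c]" by (auto simp: length_Suc_conv simp del: length_drop)
  then show ?thesis using append_take_drop_id[of k w] by metis
qed

lemma shift2_parent: "shift2 n = parent (parent n)"
proof -
  obtain w where w: "length w = n + 2" "path (N S) w = Some (state n)" "val w = n"
    using ex_word[of n "n + 2"] U_ge[of "n + 2"] by auto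
  then obtain b c where bc: "w = take n w @ [b, c]" using take_append2[of w n] by auto
  then have "path (N S) ((take n w @ [b]) @ [c]) = Some (state n)" using w by simp
  then obtain t where t: "path (N S) (take n w @ [b]) = Some t" using path_snoc by blast
  have "parent n = val (take n w @ [b])" using parent_val(1)[of "take n w @ [b]" c] bc w by simp
  then have "parent (parent n) = val (take n w)" using parent_val(1)[OF t] by simp
  then show ?thesis using shift2_val[OF w(2)] w by simp
qed

lemma sol_automata:
  "output_on E_aut (rep n) = Some (E_of (state n))" "output_on D_aut (rep n) = Some (D_of (state n))"
  "int (sol n) = int (shift2 n) + E_of (state n)"
  by (simp_all add: output_E output_D path_rep_state shift2_parent int_sol)

section \<open>The growth rate\<close>

lemma cubic_strict_mono: "s < t \<Longrightarrow> s ^ 3 - s ^ 2 + 2 * s < t ^ 3 - t ^ 2 + 2 * (t :: real)"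
proof -
  assume "s < t"
  \<comment> \<open>The quadratic cofactor is written as a sum of squares plus 1.\<close>
  have "t ^ 3 - t ^ 2 + 2 * t - (s ^ 3 - s ^ 2 + 2 * s) =
      (t - s) * ((t + s) ^ 2 / 2 + (t - 1) ^ 2 / 2 + (s - 1) ^ 2 / 2 + 1)"
    by (simp add: power3_eq_cube power2_eq_square field_simps)
  moreover have "\<dots> > 0"
    using \<open>s < t\<close> by (intro mult_pos_pos) (auto intro!: add_nonneg_pos)
  ultimately show ?thesis by simp
qed

lemma cubic_root_eq: "cubic_root ^ 3 - cubic_root ^ 2 + 2 * cubic_root - 1 = 0"
proof -
  have "\<exists>x\<ge>0. x \<le> 1 \<and> x ^ 3 - x ^ 2 + 2 * x - 1 = (0 :: real)"
    by (rule IVT') (auto intro!: continuous_intros)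
  then obtain x where x: "x ^ 3 - x ^ 2 + 2 * x - 1 = (0 :: real)" by blast
  have "y = x" if "y ^ 3 - y ^ 2 + 2 * y - 1 = 0" for y
    using cubic_strict_mono[of x y] cubic_strict_mono[of y x] x that
    by (cases x y rule: linorder_cases) auto
  then have "cubic_root = x"
    unfolding cubic_root_def by (intro the_equality x) auto
  then show ?thesis using x by simp
qed

lemma less_cubic_root_iff: "s < cubic_root \<longleftrightarrow> s ^ 3 - s ^ 2 + 2 * s < 1"
  using cubic_strict_mono[of s cubic_root] cubic_strict_mono[of cubic_root s] cubic_root_eq
  by (cases s cubic_root rule: linorder_cases) auto

lemma cubic_root_less_iff: "cubic_root < s \<longleftrightarrow> 1 < s ^ 3 - s ^ 2 + 2 * s"
  using cubic_strict_mono[of s cubic_root] cubic_strict_mono[of cubic_root s] cubic_root_eq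
  by (cases s cubic_root rule: linorder_cases) auto

lemma cubic_root_bounds: "0.56984 < cubic_root" "cubic_root < 0.569841"
  by (rule iffD2[OF less_cubic_root_iff] iffD2[OF cubic_root_less_iff],
      simp add: power3_eq_cube power2_eq_square)+

lemma cubic_root_irrational: "cubic_root \<notin> \<rat>"
proof
  assume "cubic_root \<in> \<rat>"
  then obtain r where r: "cubic_root = of_rat r" by (auto elim: Rats_cases)
  obtain q p where qp: "quotient_of r = (q, p)" by fastforce
  then have p: "p > 0" "coprime q p" "r = of_int q / of_int p"
    using quotient_of_denom_pos quotient_of_coprime quotient_of_div by auto
  have "cubic_root = of_int q / of_int p" using r p(3) by (simp add: of_rat_divide)
  then have q: "of_int q = cubic_root * real_of_int p" using p(1) by (simp add: field_simps)
  have "(of_int q ^ 3 - of_int q ^ 2 * of_int p + 2 * of_int q * of_int p ^ 2 - of_int p ^ 3 :: real) =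
      of_int p ^ 3 * (cubic_root ^ 3 - cubic_root ^ 2 + 2 * cubic_root - 1)"
    unfolding q by (simp add: algebra_simps power3_eq_cube power2_eq_square)
  also have "\<dots> = 0" using cubic_root_eq by simp
  finally have "(of_int q ^ 3 - of_int q ^ 2 * of_int p + 2 * of_int q * of_int p ^ 2 - of_int p ^ 3 :: real) = 0" .
  then have "of_int (q ^ 3 - q ^ 2 * p + 2 * q * p ^ 2 - p ^ 3) = (0 :: real)" by simp
  then have "q ^ 3 - q ^ 2 * p + 2 * q * p ^ 2 - p ^ 3 = 0" by (simp only: of_int_eq_0_iff)
  \<comment> \<open>The cubic has no root modulo 2: its homogeneous form is odd unless both
    \<open>q\<close> and \<open>p\<close> are even.\<close>
  moreover have "odd q \<or> odd p" using p(2) by (metis coprime_common_divisor dvd_refl odd_one is_unit_gcd)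
  then have "odd (q ^ 3 - q ^ 2 * p + 2 * q * p ^ 2 - p ^ 3)" by auto
  ultimately show False by simp
qed

section \<open>The deviation and the decay of its digit weights\<close>

definition dev :: "nat \<Rightarrow> real" where
  "dev n = real (sol n) - cubic_root * real n"

definition theta :: "nat \<Rightarrow> real" where
  "theta p = (if p < 2 then 0 else real (U (p - 2))) - cubic_root * real (U p)"

text \<open>Stated over any commutative ring, to serve both for the real weights
  \<open>theta\<close> and for their integer bounds \<open>theta_comb\<close>.\<close>

fun weight :: "(nat \<Rightarrow> 'a :: comm_ring_1) \<Rightarrow> bool list \<Rightarrow> 'a" where
  "weight t [] = 0"
| "weight t (b # w) = of_bool b * t (length w) + weight t w"

lemma weight_theta: "weight theta w = real (val (take (length w - 2) w)) - cubic_root * real (val w)"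
proof (induction w)
  case (Cons b w)
  show ?case
  proof (cases "length w < 2")
    case False
    then obtain k where "length w = k + 2" by (metis add.commute le_Suc_ex not_less)
    then show ?thesis using Cons by (simp add: theta_def algebra_simps)
  qed (use Cons in \<open>auto simp: theta_def algebra_simps\<close>)
qed simp

lemma dev_val: "path (N S) w = Some r \<Longrightarrow> dev (val w) = weight theta w + E_of r"
proof -
  assume w: "path (N S) w = Some r"
  have "real (sol (val w)) = of_int (int (sol (val w)))" by simp
  also have "int (sol (val w)) = int (val (take (length w - 2) w)) + E_of r"
    using sol_automata(3)[of "val w"] state_val[OF w] shift2_val[OF w] by simp
  finally show ?thesis by (simp add: dev_def weight_theta)
qed

lemma weight_append: "weight t (v @ w) = weight (\<lambda>p. t (p + length w)) v + weight t w"
  by (induction v) (auto simp: algebra_simps)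

text \<open>The plastic number, the growth rate of the weights. Equivalently
  \<open>cubic_root = 1 / rho ^ 2\<close>, so the component along \<open>rho ^ p\<close> cancels in
  \<open>theta p\<close>.\<close>

definition rho :: real where
  "rho = cubic_root / (1 - cubic_root)"

lemma rho: "rho ^ 3 = rho + 1" "1.3247 < rho" "rho < 1.325"
proof -
  obtain d where d: "d = 1 - cubic_root" by blast
  then have c: "d > 0" using cubic_root_bounds by simp
  have "rho ^ 3 - rho - 1 = (cubic_root ^ 3 - cubic_root * d ^ 2 - d ^ 3) / d ^ 3"
    using c by (simp add: rho_def d[symmetric] field_simps power3_eq_cube power2_eq_square)
  also have "cubic_root ^ 3 - cubic_root * d ^ 2 - d ^ 3 = cubic_root ^ 3 - cubic_root ^ 2 + 2 * cubic_root - 1"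
    by (simp add: d algebra_simps power3_eq_cube power2_eq_square)
  finally show "rho ^ 3 = rho + 1" using cubic_root_eq by simp
  show "1.3247 < rho" "rho < 1.325"
    using cubic_root_bounds by (simp_all add: rho_def field_simps)
qed

lemma theta_rec: "3 \<le> p \<Longrightarrow> theta (p + 3) = theta (p + 1) + theta p"
proof -
  assume "3 \<le> p"
  then obtain k where "p = k + 3" by (metis add.commute le_Suc_ex)
  then show ?thesis by (simp add: theta_def numeral_eq_Suc algebra_simps)
qed

text \<open>Dividing \<open>t ^ 3 - t - 1\<close> by \<open>t - rho\<close> leaves
  \<open>t ^ 2 + rho * t + 1 / rho\<close>. That \<open>theta\<close> satisfies this shorter
  recurrence at the start is exactly the cubic equation of \<open>cubic_root\<close>;
  \<open>theta_rec\<close> propagates it.\<close>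

lemma theta_rec2: "3 \<le> p \<Longrightarrow> theta (p + 2) = - rho * theta (p + 1) - theta p / rho"
proof (induction p rule: dec_induct)
  case base
  have "theta 3 = 2 - 4 * cubic_root" "theta 4 = 3 - 5 * cubic_root" "theta 5 = 4 - 7 * cubic_root"
    by (simp_all add: theta_def numeral_eq_Suc)
  moreover have "4 - 7 * cubic_root + rho * (3 - 5 * cubic_root) + (2 - 4 * cubic_root) / rho =
      - 2 * (cubic_root ^ 3 - cubic_root ^ 2 + 2 * cubic_root - 1) / (cubic_root * (1 - cubic_root))"
    using cubic_root_bounds by (simp add: rho_def field_simps power3_eq_cube power2_eq_square)
  ultimately show ?case using cubic_root_eq by simp
next
  case (step p)
  have "rho * (theta (p + 2) + rho * theta (p + 1) + theta p / rho) = 0" using step by simp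
  then have "rho * theta (p + 2) + rho ^ 2 * theta (p + 1) + theta p = 0"
    using rho(2) by (simp add: algebra_simps power2_eq_square)
  moreover have "rho ^ 2 = 1 + 1 / rho" using rho by (simp add: field_simps power3_eq_cube power2_eq_square)
  ultimately have "rho * theta (p + 2) + theta (p + 1) + theta (p + 1) / rho + theta p = 0"
    by (simp add: algebra_simps)
  then show ?case using theta_rec[OF step(1)] by (simp add: numeral_eq_Suc)
qed

lemma theta_bound: "3 \<le> p \<Longrightarrow> \<bar>theta p\<bar> \<le> 0.8 * 0.87 ^ p"
proof -
  assume p: "3 \<le> p"
  \<comment> \<open>The quadratic form attached to the recurrence of order 2. Each step multiplies
    it by exactly \<open>1 / rho\<close>, and it is positive definite because the two roots are not
    real.\<close>
  define energy where "energy p = theta (p + 1) ^ 2 + rho * theta (p + 1) * theta p + theta p ^ 2 / rho" for p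
  have r: "0 < rho" "1 / rho \<le> 0.7569" "0.7547 \<le> 1 / rho" "rho ^ 2 \<le> 1.756"
    using rho(2,3) power_mono[of rho "1.325" 2] by (simp_all add: field_simps power2_eq_square)
  have low: "0.3 * theta p ^ 2 \<le> energy p" for p
  proof -
    have "energy p = (theta (p + 1) + rho / 2 * theta p) ^ 2 + (1 / rho - rho ^ 2 / 4) * theta p ^ 2"
      unfolding energy_def using r(1) by (simp add: field_simps power2_eq_square)
    moreover have "0.3 * theta p ^ 2 \<le> (1 / rho - rho ^ 2 / 4) * theta p ^ 2"
      by (rule mult_right_mono) (use r in auto)
    ultimately show ?thesis
      using zero_le_power2[of "theta (p + 1) + rho / 2 * theta p"] by linarith
  qed
  \<comment> \<open>The constants fit together: 0.192 is \<open>0.3 * 0.8 ^ 2\<close>, and 0.7569 is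
    \<open>0.87 ^ 2\<close>.\<close>
  have "energy p \<le> 0.192 * (0.87 ^ p) ^ 2"
    using p
  proof (induction p rule: dec_induct)
    case base
    have t: "theta 3 = 2 - 4 * cubic_root" "theta 4 = 3 - 5 * cubic_root"
      by (simp_all add: theta_def numeral_eq_Suc)
    have "theta 4 ^ 2 \<le> 0.1508 ^ 2" "\<bar>theta 3\<bar> ^ 2 \<le> 0.279364 ^ 2"
      using cubic_root_bounds unfolding t by (intro power_mono; simp)+
    moreover from this have "theta 3 ^ 2 / rho \<le> 0.279364 ^ 2 * 0.7569"
      using mult_mono[OF _ r(2), of "theta 3 ^ 2" "0.279364 ^ 2"] r(1) by simp
    moreover have "rho * theta 4 * theta 3 \<le> 0"
      using cubic_root_bounds r(1) unfolding t by (intro mult_nonneg_nonpos) auto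
    ultimately have "theta 4 ^ 2 + rho * theta 4 * theta 3 + theta 3 ^ 2 / rho
        \<le> 0.1508 ^ 2 + 0.279364 ^ 2 * 0.7569"
      unfolding power2_abs by linarith
    also have "\<dots> \<le> 0.192 * (0.87 ^ 3) ^ 2" by (simp add: power_divide)
    finally show ?case by (simp add: energy_def)
  next
    case (step p)
    have "energy (Suc p) = energy p / rho"
    proof -
      have "(- rho * x - y / rho) ^ 2 + rho * (- rho * x - y / rho) * x + x ^ 2 / rho =
          (x ^ 2 + rho * x * y + y ^ 2 / rho) / rho" for x y
        using r(1) by (simp add: field_simps power2_eq_square)
      then show ?thesis using theta_rec2[OF step(1)] by (simp add: energy_def)
    qed
    also have "\<dots> \<le> energy p * 0.7569"
      using mult_left_mono[OF r(2), of "energy p"] low[of p] order_trans[OF _ low[of p], of 0] by simp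
    also have "\<dots> \<le> 0.192 * (0.87 ^ Suc p) ^ 2"
      using step.IH by (simp add: power2_eq_square)
    finally show ?case .
  qed
  with low[of p] have "\<bar>theta p\<bar> ^ 2 \<le> (0.8 * 0.87 ^ p) ^ 2"
    by (simp add: power_mult_distrib power2_eq_square)
  then show ?thesis by (rule power2_le_imp_le) simp
qed

text \<open>The constant is \<open>0.8 / (1 - 0.87)\<close>, rounded up.\<close>

lemma weight_tail: assumes "3 \<le> k" shows "\<bar>weight (\<lambda>p. theta (p + k)) v\<bar> \<le> 6.2 * 0.87 ^ k"
proof -
  have "\<bar>weight (\<lambda>p. theta (p + k)) v\<bar> \<le> 6.2 * 0.87 ^ k * (1 - 0.87 ^ length v)"
  proof (induction v)
    case (Cons b v)
    have "\<bar>of_bool b * theta (length v + k)\<bar> \<le> 0.8 * (0.87 ^ length v * 0.87 ^ k)"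
      using theta_bound[of "length v + k"] assms by (auto simp: power_add)
    then have "\<bar>weight (\<lambda>p. theta (p + k)) (b # v)\<bar> \<le>
        0.8 * (0.87 ^ length v * 0.87 ^ k) + 6.2 * 0.87 ^ k * (1 - 0.87 ^ length v)"
      using Cons by (simp only: weight.simps abs_triangle_ineq[THEN order_trans] add_mono)
    also have "\<dots> \<le> 6.2 * 0.87 ^ k * (1 - 0.87 ^ length (b # v))"
      using mult_nonneg_nonneg[of "0.87 ^ length v :: real" "0.87 ^ k"] by (simp add: field_simps)
    finally show ?case .
  qed simp
  also have "\<dots> \<le> 6.2 * 0.87 ^ k" by (simp add: field_simps)
  finally show ?thesis .
qed

section \<open>Dynamic programming over the 120 lowest digits\<close>

definition letters :: "letter list" where
  "letters = [S, Q1, Q2, Q3, Q4, Q5, Q7, Q8, Q9, Q10, Q11, Q12, Q13, Q14, Q15, Q16, Q17, Q18, Q19,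
     Q20, Q22, Q23, Q24, Q25, Q26, Q27]"

primrec position :: "letter \<Rightarrow> nat" where
  "position S = 0" | "position Q1 = 1" | "position Q2 = 2" | "position Q3 = 3"
| "position Q4 = 4" | "position Q5 = 5" | "position Q7 = 6" | "position Q8 = 7"
| "position Q9 = 8" | "position Q10 = 9" | "position Q11 = 10" | "position Q12 = 11"
| "position Q13 = 12" | "position Q14 = 13" | "position Q15 = 14" | "position Q16 = 15"
| "position Q17 = 16" | "position Q18 = 17" | "position Q19 = 18" | "position Q20 = 19"
| "position Q22 = 20" | "position Q23 = 21" | "position Q24 = 22" | "position Q25 = 23"
| "position Q26 = 24" | "position Q27 = 25"

lemma map_letters_nth: "map f letters ! position x = f x"
  by (cases x) (simp_all add: letters_def)

lemma position_less: "position x < 26"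
  by (cases x) simp_all

text \<open>A table of upper bounds indexed by the letter from which the last \<open>k\<close>
  digits are read. The factor \<open>e\<close> is a signed scale, so lower bounds for the deviation
  are obtained as upper bounds for its negative.\<close>

definition bounded_by :: "(nat \<Rightarrow> int) \<Rightarrow> int \<Rightarrow> nat \<Rightarrow> int list \<Rightarrow> bool" where
  "bounded_by t e k L \<longleftrightarrow> length L = 26 \<and> (\<forall>x w r. length w = k \<longrightarrow> path (N x) w = Some r \<longrightarrow>
     weight t w + e * E_of r \<le> L ! position x)"

definition dp_first :: "int \<Rightarrow> int \<Rightarrow> int list" where
  "dp_first e t = map (\<lambda>x. case children x of [] \<Rightarrow> 0 | [y] \<Rightarrow> e * E_of y
     | y # z # _ \<Rightarrow> max (e * E_of y) (e * E_of z + t)) letters"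

text \<open>Here \<open>nu\<close> replaces \<open>children\<close>: a leaf cannot be followed by
  further digits, so leaves only enter through \<open>dp_first\<close>, at the last digit.\<close>

definition dp_next :: "int list \<Rightarrow> int \<Rightarrow> int list" where
  "dp_next L t = map (\<lambda>x. case nu x of [] \<Rightarrow> 0 | [y] \<Rightarrow> L ! position y
     | y # z # _ \<Rightarrow> max (L ! position y) (L ! position z + t)) letters"

lemma children_cases:
  obtains y where "children x = [N y]" "nu x = [y]"
  | y z where "children x = [N y, N z]" "nu x = [y, z]"
  | y q where "children x = [N y, q]" "nu x = [y]" "psi q = []"
proof -
  have "(\<exists>y. children x = [N y] \<and> nu x = [y]) \<or> (\<exists>y z. children x = [N y, N z] \<and> nu x = [y, z]) \<or>
      (\<exists>y q. children x = [N y, q] \<and> nu x = [y] \<and> psi q = [])"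
    by (cases x) simp_all
  with that show thesis by blast
qed

lemma path_length_1: "length w = Suc 0 \<Longrightarrow> path q w = Some r \<Longrightarrow> \<exists>b. w = [b] \<and> step q b = Some r"
  by (cases w) (auto split: option.splits)

lemma bounded_by_first: "bounded_by t e 1 (dp_first e (t 0))"
proof -
  have "weight t w + e * E_of r \<le> dp_first e (t 0) ! position x"
    if l: "length w = 1" and p: "path (N x) w = Some r" for x w r
  proof -
    obtain b where "w = [b]" "step (N x) b = Some r" using path_length_1[of w "N x" r] l p by auto
    then show ?thesis unfolding dp_first_def map_letters_nth
      by (cases x rule: children_cases; cases b) (auto simp: step_def)
  qed
  then show ?thesis by (simp add: bounded_by_def dp_first_def letters_def)
qed

lemma bounded_by_next:
  assumes "bounded_by t e k L" "0 < k"
  shows "bounded_by t e (Suc k) (dp_next L (t k))"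
proof -
  have "weight t w + e * E_of r \<le> dp_next L (t k) ! position x"
    if l: "length w = Suc k" and p: "path (N x) w = Some r" for x w r
  proof -
    obtain b v where w: "w = b # v" "length v = k" using l by (auto simp: length_Suc_conv)
    then obtain q where q: "step (N x) b = Some q" "path q v = Some r"
      using p unfolding w(1) path_Cons_iff by blast
    obtain c u where "v = c # u" using w(2) assms(2) by (cases v) auto
    with q(2) have "psi q \<noteq> []" by (auto simp: step_def)
    then obtain y where y: "q = N y" by (cases q) auto
    have "weight t v + e * E_of r \<le> L ! position y"
      using assms(1) w(2) q(2) y by (auto simp: bounded_by_def)
    with q(1) y children_nonempty[of y] show ?thesis unfolding dp_next_def map_letters_nth w(1)
      by (cases x rule: children_cases; cases b) (auto simp: step_def w(2))
  qed
  then show ?thesis by (simp add: bounded_by_def dp_next_def letters_def)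
qed

text \<open>With \<open>a\<close> a signed power of 10 and \<open>b\<close> the number
  \<open>- a * cubic_root\<close> rounded up, this is an integer upper bound for
  \<open>a * theta p\<close>.\<close>

definition theta_comb :: "int \<Rightarrow> int \<Rightarrow> nat \<Rightarrow> int" where
  "theta_comb a b p = a * (if p < 2 then 0 else int (U (p - 2))) + b * int (U p)"

text \<open>The tuple holds the weights \<open>U (k - 2)\<close> to \<open>U (k + 1)\<close> and the bounds for words of
  length \<open>k\<close>.\<close>

fun dp_step :: "int \<Rightarrow> int \<Rightarrow> int \<times> int \<times> int \<times> int \<times> int list \<Rightarrow> int \<times> int \<times> int \<times> int \<times> int list"
  where "dp_step a b (u0, u1, u2, u3, L) = (u1, u2, u3, u2 + u1, dp_next L (a * u0 + b * u2))"

definition dp_init :: "int \<Rightarrow> int \<Rightarrow> int \<times> int \<times> int \<times> int \<times> int list" where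
  "dp_init e b = (1, 2, 3, 4, dp_next (dp_first e b) (b * 2))"

text \<open>\<open>dp_init\<close> already covers the two lowest positions, where the shift
  contributes nothing, so 118 steps lead to length 120.\<close>

definition dp_run :: "int \<Rightarrow> int \<Rightarrow> int list" where
  "dp_run a b = snd (snd (snd (snd ((dp_step a b ^^ 118) (dp_init a b)))))"


lemma dp_invariant: "\<exists>L. (dp_step a b ^^ j) (dp_init a b) =
    (int (U j), int (U (j + 1)), int (U (j + 2)), int (U (j + 3)), L) \<and>
    bounded_by (theta_comb a b) a (j + 2) L"
proof (induction j)
  case 0
  have "bounded_by (theta_comb a b) a (Suc 1) (dp_next (dp_first a b) (b * 2))"
    using bounded_by_next[OF bounded_by_first, of "theta_comb a b" a] by (simp add: theta_comb_def)
  then show ?case by (simp add: dp_init_def numeral_eq_Suc)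
next
  case (Suc j)
  then obtain L where L: "(dp_step a b ^^ j) (dp_init a b) =
      (int (U j), int (U (j + 1)), int (U (j + 2)), int (U (j + 3)), L)"
    "bounded_by (theta_comb a b) a (j + 2) L" by blast
  have "bounded_by (theta_comb a b) a (Suc (j + 2)) (dp_next L (a * int (U j) + b * int (U (j + 2))))"
    using bounded_by_next[OF L(2)] by (simp add: theta_comb_def)
  then show ?case using L(1) by (simp add: numeral_eq_Suc)
qed

lemma bounded_by_dp_run: "bounded_by (theta_comb a b) a 120 (dp_run a b)"
  using dp_invariant[where j = 118 and a = a and b = b] by (auto simp: dp_run_def)

lemma dev_le:
  fixes s m a b scale :: int
  assumes s: "s \<in> {1, -1}" "a = s * scale" "0 < scale"
    and theta: "\<And>p. of_int scale * (of_int s * theta p) \<le> of_int (theta_comb a b p)"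
    and m: "list_all (\<lambda>v. v \<le> m) (dp_run a b)"
  shows "of_int s * dev n \<le> of_int m / of_int scale + 6.2 * 0.87 ^ 120"
proof -
  obtain w where w: "length w = n + 120" "path (N S) w = Some (state n)" "val w = n"
    using ex_word[of n "n + 120"] U_ge[of "n + 120"] by auto
  define h l where "h = take n w" and "l = drop n w"
  have hl: "w = h @ l" "length l = 120" using w(1) by (simp_all add: h_def l_def)
  obtain q where q: "path (N S) h = Some q" "path q l = Some (state n)"
    using w(2) unfolding hl(1) path_append by (auto split: option.splits)
  from hl(2) obtain c u where "l = c # u" by (cases l) auto
  with q(2) have "psi q \<noteq> []" by (auto simp: step_def)
  then obtain x where x: "q = N x" by (cases q) auto
  have "weight (theta_comb a b) l + a * E_of (state n) \<le> dp_run a b ! position x"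
    using bounded_by_dp_run[of a b] hl(2) q(2) x unfolding bounded_by_def by blast
  also have "\<dots> \<le> m"
    using m bounded_by_dp_run[of a b] position_less[of x] unfolding list_all_length bounded_by_def by simp
  finally have "of_int (weight (theta_comb a b) l + a * E_of (state n)) \<le> (of_int m :: real)"
    by (simp only: of_int_le_iff)
  moreover have "of_int scale * (of_int s * weight theta l) \<le> of_int (weight (theta_comb a b) l)"
  proof (induction l)
    case (Cons c l)
    then show ?case using theta[of "length l"] by (cases c) (simp_all add: algebra_simps)
  qed simp
  ultimately have "of_int scale * (of_int s * (weight theta l + of_int (E_of (state n)))) \<le> of_int m"
    by (simp add: s(2) algebra_simps)
  then have "of_int s * (weight theta l + of_int (E_of (state n))) \<le> of_int m / of_int scale"
    using s(3) by (simp add: field_simps)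
  moreover have "of_int s * weight (\<lambda>p. theta (p + 120)) h \<le> 6.2 * 0.87 ^ 120"
    using weight_tail[of 120 h] s(1) by auto
  moreover have "dev n = weight (\<lambda>p. theta (p + 120)) h + (weight theta l + of_int (E_of (state n)))"
    using dev_val[OF w(2)] unfolding w(3) by (simp add: hl weight_append)
  ultimately show ?thesis by (simp add: distrib_left)
qed

text \<open>Words of 120 digits have values below \<open>10 ^ 15\<close>, so rounding at the 24th
  decimal changes their weight by less than \<open>10 ^ (-9)\<close>.\<close>

lemma cubic_root_digits:
  "569840290998053265911399 / 10 ^ 24 < cubic_root" "cubic_root < 569840290998053265911400 / 10 ^ 24"
  by (rule iffD2[OF less_cubic_root_iff] iffD2[OF cubic_root_less_iff],
      simp add: power3_eq_cube power2_eq_square)+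

lemma dev_upper: "dev n < 1.155081"
proof -
  have "of_int (10 ^ 24) * (of_int 1 * theta p) \<le> of_int (theta_comb (10 ^ 24) (- 569840290998053265911399) p)" for p
    using mult_right_mono[OF less_imp_le[OF cubic_root_digits(1)], of "real (U p)"]
    by (auto simp: theta_comb_def theta_def field_simps)
  \<comment> \<open>This bound stays \<open>6 * 10 ^ (-7)\<close> below the claimed one, which
    leaves room for the tail \<open>6.2 * 0.87 ^ 120\<close>, less than
    \<open>4 * 10 ^ (-7)\<close>.\<close>
  moreover have "list_all (\<lambda>v. v \<le> 1155080400000000000000000) (dp_run (10 ^ 24) (- 569840290998053265911399))"
    by code_simp
  ultimately have "of_int 1 * dev n \<le> of_int 1155080400000000000000000 / of_int (10 ^ 24) + 6.2 * 0.87 ^ 120"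
    by (intro dev_le[where b = "- 569840290998053265911399" and a = "10 ^ 24"]) auto
  also have "\<dots> < 1.155081" by (simp add: power_divide)
  finally show ?thesis by simp
qed

lemma dev_lower: "- 1.049234 < dev n"
proof -
  have "of_int (10 ^ 24) * (of_int (- 1) * theta p) \<le> of_int (theta_comb (- (10 ^ 24)) 569840290998053265911400 p)" for p
    using mult_right_mono[OF less_imp_le[OF cubic_root_digits(2)], of "real (U p)"]
    by (auto simp: theta_comb_def theta_def field_simps)
  moreover have "list_all (\<lambda>v. v \<le> 1049233500000000000000000) (dp_run (- (10 ^ 24)) 569840290998053265911400)"
    by code_simp
  ultimately have "of_int (- 1) * dev n \<le> of_int 1049233500000000000000000 / of_int (10 ^ 24) + 6.2 * 0.87 ^ 120"
    by (intro dev_le[where b = 569840290998053265911400 and a = "- (10 ^ 24)"]) auto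
  also have "\<dots> < 1.049234" by (simp add: power_divide)
  finally show ?thesis by simp
qed

lemma dev_range: "dev n < 116 / 100" "- 105 / 100 < dev n"
  using dev_upper[of n] dev_lower[of n] by simp_all

section \<open>Limit, floor differences, balance and aperiodicity\<close>

lemma sol_limit: "(\<lambda>n. real (sol n) / real n) \<longlonglongrightarrow> cubic_root"
proof -
  have "\<forall>\<^sub>F n in sequentially. norm (real (sol n) / real n - cubic_root) \<le> norm (inverse (real n)) * 2"
  proof (rule eventually_sequentiallyI[of 1])
    fix n :: nat assume "1 \<le> n"
    then have "real (sol n) / real n - cubic_root = dev n * inverse (real n)"
      by (simp add: dev_def field_simps)
    moreover have "\<bar>dev n\<bar> \<le> 2" using dev_range[of n] by linarith
    ultimately show "norm (real (sol n) / real n - cubic_root) \<le> norm (inverse (real n)) * 2"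
      using mult_right_mono[of "\<bar>dev n\<bar>" 2 "inverse (real n)"] by (simp add: abs_mult)
  qed
  then have "(\<lambda>n. real (sol n) / real n - cubic_root) \<longlonglongrightarrow> 0"
    by (rule tendsto_0_le[OF lim_inverse_n])
  then show ?thesis by (rule LIM_zero_cancel)
qed

lemma sol_val:
  assumes "path (N S) w = Some r"
  shows "int (sol (val w)) = int (val (take (length w - 2) w)) + E_of r"
  using sol_automata(3)[of "val w"] shift2_val[OF assms] state_val[OF assms] by simp

text \<open>The entries of the list are the lengths of the runs of digits 0 after each digit 1.\<close>

fun word :: "nat list \<Rightarrow> bool list" where
  "word [] = []"
| "word (g # l) = True # replicate g False @ word l"

text \<open>The witnesses 2, 93 and 1167 serve the floor differences; the others are the ends of two
  blocks of length 72 for the balance constant.\<close>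

lemma sol_values: "sol 2 = 1" "sol 93 = 54" "sol 135 = 76" "sol 207 = 119" "sol 214 = 123"
  "sol 286 = 162" "sol 1167 = 664"
proof -
  have "sol n = m"
    if "case path (N S) w of None \<Rightarrow> False | Some r \<Rightarrow> val w = n \<and> int (val (take (length w - 2) w)) + E_of r = int m"
    for w n m
    using that sol_val[of w] by (auto split: option.splits)
  note * = this
  show "sol 2 = 1" by (rule *[of "word [1]"]) code_simp
  show "sol 93 = 54" by (rule *[of "word [8, 5]"]) code_simp
  show "sol 135 = 76" by (rule *[of "word [5, 9]"]) code_simp
  show "sol 207 = 119" by (rule *[of "word [11, 5]"]) code_simp
  show "sol 214 = 123" by (rule *[of "word [9, 5, 1]"]) code_simp
  show "sol 286 = 162" by (rule *[of "word [8, 9]"]) code_simp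
  show "sol 1167 = 664" by (rule *[of "word [8, 14]"]) code_simp
qed

lemma floor_differences: "{int (sol n) - \<lfloor>cubic_root * real n\<rfloor> | n. n \<ge> 1} = {- 1, 0, 1, 2}"
proof
  show "{int (sol n) - \<lfloor>cubic_root * real n\<rfloor> | n. n \<ge> 1} \<subseteq> {- 1, 0, 1, 2}"
  proof
    fix v assume "v \<in> {int (sol n) - \<lfloor>cubic_root * real n\<rfloor> | n. n \<ge> 1}"
    then obtain n where v: "v = int (sol n) - \<lfloor>cubic_root * real n\<rfloor>" by blast
    \<comment> \<open>The difference \<open>v - dev n\<close> is the fractional part of
      \<open>cubic_root * n\<close>.\<close>
    have "of_int v \<ge> dev n" "of_int v < dev n + 1"
      unfolding v dev_def by (simp_all, linarith+)
    then have "of_int v > (- 2 :: real)" "of_int v < (3 :: real)"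
      using dev_range[of n] by linarith+
    then have "v > - 2" "v < 3" by linarith+
    then show "v \<in> {- 1, 0, 1, 2}" by auto
  qed
next
  have "\<lfloor>cubic_root * real 1\<rfloor> = 0" "\<lfloor>cubic_root * real 2\<rfloor> = 1" "\<lfloor>cubic_root * real 93\<rfloor> = 52"
    "\<lfloor>cubic_root * real 1167\<rfloor> = 665"
    using cubic_root_bounds by (simp_all add: floor_eq_iff)
  then have "int (sol 1) - \<lfloor>cubic_root * real 1\<rfloor> = 1" "int (sol 2) - \<lfloor>cubic_root * real 2\<rfloor> = 0"
    "int (sol 93) - \<lfloor>cubic_root * real 93\<rfloor> = 2" "int (sol 1167) - \<lfloor>cubic_root * real 1167\<rfloor> = - 1"
    using sol_values sol_1 by (simp_all only:)
  moreover have mem: "f n \<in> {f n | n. n \<ge> 1}" if "n \<ge> 1" for f :: "nat \<Rightarrow> int" and n :: nat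
    using that by blast
  note mem[of 1 "\<lambda>n. int (sol n) - \<lfloor>cubic_root * real n\<rfloor>"] mem[of 2 "\<lambda>n. int (sol n) - \<lfloor>cubic_root * real n\<rfloor>"]
    mem[of 93 "\<lambda>n. int (sol n) - \<lfloor>cubic_root * real n\<rfloor>"] mem[of 1167 "\<lambda>n. int (sol n) - \<lfloor>cubic_root * real n\<rfloor>"]
  ultimately show "{- 1, 0, 1, 2} \<subseteq> {int (sol n) - \<lfloor>cubic_root * real n\<rfloor> | n. n \<ge> 1}"
    by (simp only: insert_subset empty_subsetI)
qed

lemma diff_word_sol: "diff_word sol n = D_of (state n)"
  using sol_Suc[of n] by (simp add: diff_word_def)

lemma count_ones: "i \<le> j \<Longrightarrow> int (count_list (map (diff_word sol) [i..<j]) 1) = int (sol j) - int (sol i)"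
proof (induction j rule: dec_induct)
  case (step j)
  then show ?case using D_of_range[of "state j"] by (auto simp: diff_word_sol sol_Suc)
qed simp

lemma count_zeros: "count_list (map (diff_word sol) l) 0 + count_list (map (diff_word sol) l) 1 = length l"
  using D_of_range by (induction l) (auto simp: diff_word_sol)

lemma balance_constant_4: "balance_constant (diff_word sol) 4"
  unfolding balance_constant_def
proof (intro allI impI)
  fix u v x
  assume "is_factor u (diff_word sol) \<and> is_factor v (diff_word sol) \<and> length u = length v"
  then obtain i j where u: "u = map (diff_word sol) [i..<i + length u]"
    and v: "v = map (diff_word sol) [j..<j + length u]" and l: "length u = length v"
    unfolding is_factor_def by metis
  have cu: "int (count_list u 1) = int (sol (i + length u)) - int (sol i)"
    using count_ones[of i "i + length u"] u by simp
  have cv: "int (count_list v 1) = int (sol (j + length u)) - int (sol j)"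
    using count_ones[of j "j + length u"] v by simp
  \<comment> \<open>Two differences of deviations, each less than 2.21 in absolute value, so less
    than 4.42 together; an integer below 5 is at most 4.\<close>
  have "of_int (int (count_list u 1) - int (count_list v 1)) =
      dev (i + length u) - dev i - (dev (j + length u) - dev j)"
    unfolding cu cv by (simp add: dev_def algebra_simps)
  then have "\<bar>of_int (int (count_list u 1) - int (count_list v 1)) :: real\<bar> < 5"
    using dev_range[of i] dev_range[of j] dev_range[of "i + length u"] dev_range[of "j + length u"]
    by linarith
  then have 1: "\<bar>int (count_list u 1) - int (count_list v 1)\<bar> \<le> 4" by linarith
  have z: "count_list u 0 + count_list u 1 = length u" "count_list v 0 + count_list v 1 = length v"
    using count_zeros u v by (metis length_map)+
  have "set (map (diff_word sol) l) \<subseteq> {0, 1}" for l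
    using D_of_range by (auto simp: diff_word_sol)
  then have r: "set u \<subseteq> {0, 1}" "set v \<subseteq> {0, 1}" using u v by metis+
  consider "x = 1" | "x = 0" | "x \<notin> set u \<union> set v" using r by blast
  then show "\<bar>int (count_list u x) - int (count_list v x)\<bar> \<le> int 4"
  proof cases
    case 2
    have "int (count_list u 0) + int (count_list u 1) = int (count_list v 0) + int (count_list v 1)"
      using z l by (metis of_nat_add)
    then show ?thesis using 1 2 by auto
  next
    case 3
    then have "count_list u x = 0" "count_list v x = 0" by (simp_all add: count_list_0_iff)
    then show ?thesis by simp
  qed (use 1 in simp)
qed

lemma least_balance_constant_4: "least_balance_constant (diff_word sol) 4"
  unfolding least_balance_constant_def
proof (intro conjI allI impI balance_constant_4)
  fix C
  assume C: "balance_constant (diff_word sol) C"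
  have "\<bar>int (sol (i + l)) - int (sol i) - (int (sol (j + l)) - int (sol j))\<bar> \<le> int C" for i j l
  proof -
    let ?u = "map (diff_word sol) [i..<i + l]" and ?v = "map (diff_word sol) [j..<j + l]"
    have "is_factor ?u (diff_word sol)" "is_factor ?v (diff_word sol)" "length ?u = length ?v"
      unfolding is_factor_def by auto
    then have "\<bar>int (count_list ?u 1) - int (count_list ?v 1)\<bar> \<le> int C"
      using C unfolding balance_constant_def by blast
    then show ?thesis by (simp add: count_ones)
  qed
  \<comment> \<open>The blocks of length 72 starting at 135 and 214 contain 43 and 39 letters
    1.\<close>
  from this[of 135 72 214] show "4 \<le> C" using sol_values by simp
qed

text \<open>Along a progression whose difference is a period, \<open>dev\<close> is eventually
  affine. Being bounded it has slope 0, which would make \<open>cubic_root\<close> rational.\<close>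

lemma not_ultimately_periodic: "\<not> ultimately_periodic (diff_word sol)"
proof
  assume "ultimately_periodic (diff_word sol)"
  then obtain p N where p: "p > 0" and per: "\<And>n. n \<ge> N \<Longrightarrow> diff_word sol (n + p) = diff_word sol n"
    unfolding ultimately_periodic_def by blast
  define q where "q = int (sol (N + p)) - int (sol N)"
  have step: "int (sol (n + p)) - int (sol n) = q" if "n \<ge> N" for n
    using that
  proof (induction n rule: dec_induct)
    case (step n)
    then show ?case using per[of n] by (simp add: diff_word_def)
  qed (simp add: q_def)
  have sol: "int (sol (N + j * p)) = int (sol N) + int j * q" for j
  proof (induction j)
    case (Suc j)
    then show ?case using step[of "N + j * p"] by (simp add: algebra_simps)
  qed simp
  define t where "t = of_int q - cubic_root * real p"
  have dev: "dev (N + j * p) = dev N + real j * t" for j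
  proof -
    have "real (sol (N + j * p)) = real (sol N) + real j * of_int q"
      using arg_cong[OF sol[of j], of real_of_int] by simp
    then show ?thesis by (simp add: dev_def t_def algebra_simps)
  qed
  have "t = 0"
  proof (rule ccontr)
    assume "t \<noteq> 0"
    then obtain j where "3 < real j * \<bar>t\<bar>" using reals_Archimedean3[of "\<bar>t\<bar>"] by auto
    then have "3 < \<bar>dev (N + j * p) - dev N\<bar>" unfolding dev by (simp add: abs_mult)
    then show False
      using dev_range[of N] dev_range[of "N + j * p"] by linarith
  qed
  then have "cubic_root = of_int q / of_nat p" using p by (simp add: t_def field_simps)
  moreover have "real_of_int q / real p \<in> \<rat>" by simp
  ultimately show False using cubic_root_irrational by metis
qed

section \<open>The difference word\<close>

lemma lim_word_eq: "converges_to_word u w \<Longrightarrow> lim_word u = w"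
  unfolding lim_word_def using converges_to_word_unique by blast

lemma converges_to_word_prefixes:
  assumes "\<And>k. u k = map w [0..<L k]" "\<And>k. k \<le> L k"
  shows "converges_to_word u w"
  unfolding converges_to_word_def
proof
  fix i
  have "i < length (u k) \<and> u k ! i = w i" if "Suc i \<le> k" for k
    using assms(2)[of k] that by (simp add: assms(1))
  then show "\<exists>K. \<forall>k\<ge>K. i < length (u k) \<and> u k ! i = w i" by blast
qed

text \<open>Needed for \<open>nu\<close>: unlike for \<open>psi\<close>, whose fixed point is
  \<open>state\<close>, no explicit description of the limit is at hand, so it is built from the
  chain of prefixes.\<close>

lemma prefix_chain_limit:
  assumes chain: "\<And>k. \<exists>z. u (Suc k) = u k @ z" and long: "\<And>k. k \<le> length (u k)"
  shows "u k = map (lim_word u) [0..<length (u k)]"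
proof -
  have "\<exists>z. u (j + m) = u j @ z" for j m
  proof (induction m)
    case (Suc m)
    then show ?case using chain[of "j + m"] by auto
  qed simp
  then have nth: "u k ! i = u j ! i" if "j \<le> k" "i < length (u j)" for i j k
    using that by (metis le_add_diff_inverse nth_append)
  define w where "w i = u (Suc i) ! i" for i
  have w: "u k ! i = w i" if "i < length (u k)" for i k
    using nth[of "Suc i" k i] nth[of k "Suc i" i] that long[of "Suc i"]
    unfolding w_def by (cases "k \<le> Suc i") auto
  have eq: "u k = map w [0..<length (u k)]" for k
    by (rule nth_equalityI) (simp_all add: w)
  have "lim_word u = w"
    by (rule lim_word_eq, rule converges_to_word_prefixes[OF eq long])
  then show ?thesis using eq by metis
qed

lemma UNIV_letter: "UNIV = set letters"
proof -
  have "x \<in> set letters" for x by (cases x) (simp_all add: letters_def)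
  then show ?thesis by blast
qed

lemma card_letter: "card (UNIV :: letter set) = 26"
  unfolding UNIV_letter by (simp add: letters_def)

lemma finite_node: "finite (UNIV :: node set)"
proof -
  have "q \<in> insert X6 (insert X21 (insert X28 (N ` set letters)))" for q
    using UNIV_letter by (cases q) auto
  then show ?thesis by (metis (no_types) List.finite_set finite_imageI finite_insert finite_subset subsetI)
qed

text \<open>Since \<open>psi\<close> erases leaves, its being prolongable requires that the levels
  below \<open>Q1\<close> never die out; their sizes are gaps between consecutive weights.\<close>

lemma psi_iterate_Q1: "(apply_morphism psi ^^ k) [N Q1] \<noteq> []"
proof -
  have "length ((apply_morphism psi ^^ k) [N Q1]) = cap (N Q1) k"
    unfolding map_snd_nodes[symmetric] by (simp add: length_nodes)
  then show ?thesis using U_less_Suc[of k] by auto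
qed

lemma morphic_state_image: "morphic (\<lambda>n. h (state n))"
proof -
  obtain m and enc :: "node \<Rightarrow> nat" where enc: "inj enc"
    using finite_imp_inj_to_nat_seg[OF finite_node] by auto
  define f where "f = (\<lambda>x. map enc (psi (inv enc x)))"
  have f: "apply_morphism f (map enc l) = map enc (apply_morphism psi l)" for l
    using enc by (simp add: apply_morphism_def f_def map_concat o_def)
  have iterate: "(apply_morphism f ^^ k) [enc q] = map enc ((apply_morphism psi ^^ k) [q])" for k q
    by (induction k) (simp_all add: f)
  have "omega_word f (enc (N S)) = enc \<circ> state"
    unfolding omega_word_def
    by (intro lim_word_eq converges_to_word_prefixes[of _ _ U] less_imp_le U_ge)
       (simp add: iterate map_state[symmetric])
  then have "(\<lambda>n. h (state n)) = (\<lambda>n. (h \<circ> inv enc) (omega_word f (enc (N S)) n))"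
    using enc by simp
  moreover have "prolongable f (enc (N S))"
    unfolding prolongable_def
    by (rule exI[of _ "[enc (N Q1)]"]) (use enc in \<open>simp add: iterate psi_iterate_Q1\<close>, simp add: f_def)
  moreover have "\<forall>x\<in>range enc. set (f x) \<subseteq> range enc" by (auto simp: f_def)
  ultimately show ?thesis
    unfolding morphic_def using finite_imageI[OF finite_node, of enc] by blast
qed

lemma morphic_diff_word: "morphic (diff_word sol)"
  using morphic_state_image[of D_of] by (simp add: diff_word_sol[abs_def])

primrec inner :: "node \<Rightarrow> letter list" where
  "inner (N x) = [x]" | "inner X6 = []" | "inner X21 = []" | "inner X28 = []"

lemma nu_inner: "nu x = apply_morphism inner (children x)"
  by (cases x) (simp_all add: apply_morphism_def)

lemma eta_children: "eta x = map D_of (children x)"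
  by (cases x) simp_all

text \<open>Deleting the leaves turns \<open>psi\<close> into \<open>nu\<close>. The deleted leaves
  are recovered one level further down, because \<open>eta\<close> writes the outputs of all
  children, leaves included.\<close>

lemma nu_eta_inner:
  "apply_morphism nu (apply_morphism inner l) = apply_morphism inner (apply_morphism psi l)"
  "apply_morphism eta (apply_morphism inner l) = map D_of (apply_morphism psi l)"
proof -
  have "apply_morphism nu (inner q) = apply_morphism inner (psi q)"
    "apply_morphism eta (inner q) = map D_of (psi q)" for q
    by (cases q; simp add: apply_morphism_def nu_inner eta_children)+
  then show "apply_morphism nu (apply_morphism inner l) = apply_morphism inner (apply_morphism psi l)"
    "apply_morphism eta (apply_morphism inner l) = map D_of (apply_morphism psi l)"
    by (induction l) (simp_all add: apply_morphism_def)
qed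

lemma non_erasing: "non_erasing nu" "non_erasing eta"
proof -
  have "nu x \<noteq> []" "eta x \<noteq> []" for x by (cases x; simp)+
  then show "non_erasing nu" "non_erasing eta" by (simp_all add: non_erasing_def)
qed

lemma nu_iterate: "(apply_morphism nu ^^ k) [S] = apply_morphism inner (map state [0..<U k])"
proof -
  have "(apply_morphism nu ^^ k) [S] = apply_morphism inner ((apply_morphism psi ^^ k) [N S])"
    by (induction k) (simp_all add: nu_eta_inner(1), simp add: apply_morphism_def)
  then show ?thesis by (simp add: map_state)
qed

lemma eta_nu_iterate: "apply_morphism eta ((apply_morphism nu ^^ k) [S]) = map (diff_word sol) [0..<U (Suc k)]"
proof -
  have "apply_morphism psi (map state [0..<U k]) = map state [0..<U (Suc k)]"
    by (simp add: map_state)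
  then show ?thesis by (simp add: nu_iterate nu_eta_inner(2) diff_word_sol)
qed

lemma length_apply_morphism_ge:
  "non_erasing f \<Longrightarrow> length l \<le> length (apply_morphism f l)"
proof (induction l)
  case (Cons x l)
  then obtain y z where "f x = y # z" unfolding non_erasing_def by (meson list.exhaust)
  then show ?case using Cons by (simp add: apply_morphism_def)
qed (simp add: apply_morphism_def)

lemma apply_morphism_append: "apply_morphism f (u @ v) = apply_morphism f u @ apply_morphism f v"
  by (simp add: apply_morphism_def)

lemma nu_iterate_chain: "\<exists>z. (apply_morphism nu ^^ Suc k) [S] = (apply_morphism nu ^^ k) [S] @ z"
proof -
  have "[0..<U (Suc k)] = [0..<U k] @ [U k..<U (Suc k)]"
    using U_le_Suc[of k] upt_add_eq_append[of 0 "U k" "U (Suc k) - U k"] by simp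
  then show ?thesis unfolding nu_iterate by (simp add: apply_morphism_append)
qed

lemma nu_iterate_long: "k \<le> length ((apply_morphism nu ^^ k) [S])"
proof (induction k)
  case (Suc k)
  have eq: "(apply_morphism nu ^^ Suc k) [S] = (apply_morphism nu ^^ k) [S] @ (apply_morphism nu ^^ k) [Q1]"
    for k by (induction k) (simp_all add: apply_morphism_append, simp add: apply_morphism_def)
  have "0 < length ((apply_morphism nu ^^ k) [Q1])"
  proof (induction k)
    case (Suc k)
    then show ?case
      using length_apply_morphism_ge[OF non_erasing(1), of "(apply_morphism nu ^^ k) [Q1]"]
      by (simp only: funpow.simps o_apply)
  qed simp
  then show ?case using Suc unfolding eq length_append by linarith
qed simp

lemma map_upt_prefix:
  assumes "map f [0..<m] = v @ z"
  shows "v = map f [0..<length v]"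
proof -
  have "length v \<le> m" using arg_cong[OF assms, of length] by simp
  have "v = take (length v) (map f [0..<m])" by (simp add: assms)
  also have "\<dots> = map f [0..<length v]" using \<open>length v \<le> m\<close> by (simp add: take_map)
  finally show ?thesis .
qed

lemma diff_word_presentation: "diff_word sol = apply_morphism_inf eta (omega_word nu S)"
proof -
  let ?w = "omega_word nu S" and ?u = "\<lambda>k. (apply_morphism nu ^^ k) [S]"
  let ?v = "\<lambda>k. apply_morphism eta (map ?w [0..<k])"
  have u: "?u k = map ?w [0..<length (?u k)]" for k
    unfolding omega_word_def by (rule prefix_chain_limit[OF nu_iterate_chain nu_iterate_long])
  have "?v k = map (diff_word sol) [0..<length (?v k)]" for k
  proof -
    \<comment> \<open>The prefix of length \<open>k\<close> lies inside the iterate, whose image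
      under \<open>eta\<close> is already known to be a prefix of the difference word.\<close>
    have "[0..<length (?u k)] = [0..<k] @ [k..<length (?u k)]"
      using nu_iterate_long[of k] upt_add_eq_append[of 0 k "length (?u k) - k"] by simp
    then have "?u k = map ?w [0..<k] @ map ?w [k..<length (?u k)]" using u[of k] by simp
    then have "map (diff_word sol) [0..<U (Suc k)] = ?v k @ apply_morphism eta (map ?w [k..<length (?u k)])"
      using eta_nu_iterate[of k] by (metis apply_morphism_append)
    then show ?thesis by (rule map_upt_prefix)
  qed
  moreover have "k \<le> length (?v k)" for k
    using length_apply_morphism_ge[OF non_erasing(2), of "map ?w [0..<k]"] by simp
  ultimately have "converges_to_word ?v (diff_word sol)" by (rule converges_to_word_prefixes)
  then show ?thesis unfolding apply_morphism_inf_def by (simp add: lim_word_eq)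
qed

section \<open>Total recursive functions\<close>

lemma arg_Cons [simp]: "arg 0 (x # xs) = x" "arg (Suc i) (x # xs) = arg i xs"
  by (simp_all add: arg_def)

lemma tr_comp1:
  assumes "total_recursive (\<lambda>xs. f (arg 0 xs))" "total_recursive g"
  shows "total_recursive (\<lambda>xs. f (g xs))"
  using total_recursive.comp[OF assms(1), of "[g]"] assms(2) by simp

lemma tr_comp3:
  assumes "total_recursive (\<lambda>xs. f (arg 0 xs) (arg 1 xs) (arg 2 xs))"
    "total_recursive g" "total_recursive h" "total_recursive k"
  shows "total_recursive (\<lambda>xs. f (g xs) (h xs) (k xs))"
  using total_recursive.comp[OF assms(1), of "[g, h, k]"] assms(2-4) by (simp add: numeral_eq_Suc)

lemma tr_const: "total_recursive (\<lambda>xs. c)"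
proof (induction c)
  case (Suc c)
  then show ?case using tr_comp1[OF total_recursive.succ] by blast
qed (rule total_recursive.zero)

lemma tr_Suc: "total_recursive f \<Longrightarrow> total_recursive (\<lambda>xs. Suc (f xs))"
  by (rule tr_comp1[OF total_recursive.succ])

lemma tr_rec:
  assumes "total_recursive (\<lambda>xs. f (arg 0 xs) (arg 1 xs))"
    and "total_recursive (\<lambda>xs. g (arg 0 xs) (arg 1 xs) (arg 2 xs) (arg 3 xs))"
    and "total_recursive n" "total_recursive a" "total_recursive b"
  shows "total_recursive (\<lambda>xs. rec_nat (f (a xs) (b xs)) (\<lambda>i r. g r i (a xs) (b xs)) (n xs))"
  using total_recursive.comp[OF total_recursive.prim_rec[OF assms(1,2)], of "[n, a, b]"] assms(3-5)
  by (simp add: numeral_eq_Suc)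

lemmas tr_basic = tr_const tr_Suc total_recursive.proj

lemma tr_add:
  assumes "total_recursive f" "total_recursive g"
  shows "total_recursive (\<lambda>xs. f xs + g xs)"
proof -
  have "x + n = rec_nat x (\<lambda>i r. Suc r) n" for x n :: nat by (induction n) auto
  then have eq: "(\<lambda>xs. f xs + g xs) = (\<lambda>xs. rec_nat (f xs) (\<lambda>i r. Suc r) (g xs))" by blast
  show ?thesis unfolding eq
    by (rule tr_rec[of "\<lambda>x y. x" "\<lambda>r i x y. Suc r" g f f]) (intro tr_basic assms)+
qed

lemma tr_mult:
  assumes "total_recursive f" "total_recursive g"
  shows "total_recursive (\<lambda>xs. f xs * g xs)"
proof -
  have "x * n = rec_nat 0 (\<lambda>i r. r + x) n" for x n :: nat by (induction n) auto
  then have eq: "(\<lambda>xs. f xs * g xs) = (\<lambda>xs. rec_nat 0 (\<lambda>i r. r + f xs) (g xs))" by blast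
  show ?thesis unfolding eq
    by (rule tr_rec[of "\<lambda>x y. 0" "\<lambda>r i x y. r + x" g f f]) (intro tr_basic tr_add assms)+
qed

lemma tr_diff:
  assumes "total_recursive f" "total_recursive g"
  shows "total_recursive (\<lambda>xs. f xs - g xs)"
proof -
  have "n - 1 = rec_nat 0 (\<lambda>i r. i) n" for n :: nat by (cases n) auto
  then have "(\<lambda>xs. h xs - 1) = (\<lambda>xs. rec_nat 0 (\<lambda>i r. i) (h xs))" for h :: "nat list \<Rightarrow> nat"
    by blast
  then have pred: "total_recursive (\<lambda>xs. h xs - 1)" if "total_recursive h" for h
    using tr_rec[of "\<lambda>x y. 0" "\<lambda>r i x y. i" h h h, OF tr_const total_recursive.proj that that that]
    by metis
  have "x - n = rec_nat x (\<lambda>i r. r - 1) n" for x n :: nat by (induction n) auto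
  then have eq: "(\<lambda>xs. f xs - g xs) = (\<lambda>xs. rec_nat (f xs) (\<lambda>i r. r - 1) (g xs))" by blast
  show ?thesis unfolding eq
    by (rule tr_rec[of "\<lambda>x y. x" "\<lambda>r i x y. r - 1" g f f]) (intro tr_basic pred assms)+
qed

lemma tr_power:
  assumes "total_recursive f" "total_recursive g"
  shows "total_recursive (\<lambda>xs. f xs ^ g xs)"
proof -
  have "x ^ n = rec_nat 1 (\<lambda>i r. r * x) n" for x n :: nat by (induction n) auto
  then have eq: "(\<lambda>xs. f xs ^ g xs) = (\<lambda>xs. rec_nat 1 (\<lambda>i r. r * f xs) (g xs))" by blast
  show ?thesis unfolding eq
    by (rule tr_rec[of "\<lambda>x y. 1" "\<lambda>r i x y. r * x" g f f]) (intro tr_basic tr_mult assms)+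
qed

lemma tr_sum:
  assumes "total_recursive (\<lambda>xs. h (arg 0 xs) (arg 1 xs) (arg 2 xs))"
    and "total_recursive n" "total_recursive a" "total_recursive b"
  shows "total_recursive (\<lambda>xs. \<Sum>i<n xs. h i (a xs) (b xs))"
proof -
  have "(\<Sum>i<m. h i x y) = rec_nat 0 (\<lambda>i r. r + h i x y) m" for m x y by (induction m) auto
  then have eq: "(\<lambda>xs. \<Sum>i<n xs. h i (a xs) (b xs)) =
      (\<lambda>xs. rec_nat 0 (\<lambda>i r. r + h i (a xs) (b xs)) (n xs))" by blast
  have "total_recursive (\<lambda>xs. h (arg 1 xs) (arg 2 xs) (arg 3 xs))"
    by (rule tr_comp3[OF assms(1)]) (rule total_recursive.proj)+
  then show ?thesis unfolding eq
    by (intro tr_rec[of "\<lambda>x y. 0" "\<lambda>r i x y. r + h i x y" n a b] tr_basic tr_add assms)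
qed

definition max_below :: "nat \<Rightarrow> (nat \<Rightarrow> nat) \<Rightarrow> nat" where
  "max_below n h = rec_nat 0 (\<lambda>i r. max r (h i)) n"

lemma max_below_ge: "i < n \<Longrightarrow> h i \<le> max_below n h"
  by (induction n) (auto simp: max_below_def less_Suc_eq)

lemma max_below_attained: "0 < n \<Longrightarrow> \<exists>i<n. max_below n h = h i"
proof (induction n)
  case (Suc n)
  have "max_below (Suc n) h = max (max_below n h) (h n)" by (simp add: max_below_def)
  then show ?case using Suc by (cases "n = 0") (auto simp: max_def max_below_def intro: less_SucI)
qed simp

lemma tr_max_below:
  assumes "total_recursive (\<lambda>xs. h (arg 0 xs) (arg 1 xs) (arg 2 xs))"
    and "total_recursive n" "total_recursive a" "total_recursive b"
  shows "total_recursive (\<lambda>xs. max_below (n xs) (\<lambda>i. h i (a xs) (b xs)))"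
proof -
  \<comment> \<open>With truncated subtraction, \<open>r + (h - r)\<close> is the maximum.\<close>
  have "max_below m (\<lambda>i. h i x y) = rec_nat 0 (\<lambda>i r. r + (h i x y - r)) m" for m x y
    unfolding max_below_def by (rule arg_cong[of _ _ "\<lambda>f. rec_nat 0 f m"]) (auto simp: fun_eq_iff)
  then have eq: "(\<lambda>xs. max_below (n xs) (\<lambda>i. h i (a xs) (b xs))) =
      (\<lambda>xs. rec_nat 0 (\<lambda>i r. r + (h i (a xs) (b xs) - r)) (n xs))" by blast
  have "total_recursive (\<lambda>xs. h (arg 1 xs) (arg 2 xs) (arg 3 xs))"
    by (rule tr_comp3[OF assms(1)]) (rule total_recursive.proj)+
  then show ?thesis unfolding eq
    by (intro tr_rec[of "\<lambda>x y. 0" "\<lambda>r i x y. r + (h i x y - r)" n a b] tr_basic tr_add tr_diff assms)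
qed

lemma tr_least:
  assumes "total_recursive (\<lambda>xs. f (arg 0 xs) (arg 1 xs) (arg 2 xs))" "\<And>x y. \<exists>j. f j x y = 0"
    and "total_recursive g" "total_recursive h"
  shows "total_recursive (\<lambda>xs. LEAST j. f j (g xs) (h xs) = 0)"
proof -
  have "total_recursive (\<lambda>xs. LEAST j. (\<lambda>xs. f (arg 0 xs) (arg 1 xs) (arg 2 xs)) (j # xs) = 0)"
    by (rule total_recursive.minim[OF assms(1)]) (use assms(2) in \<open>simp add: numeral_eq_Suc\<close>)
  from total_recursive.comp[OF this, of "[g, h]"] show ?thesis
    using assms(3,4) by (simp add: numeral_eq_Suc)
qed

lemmas tr_intros = tr_const tr_Suc total_recursive.proj tr_add tr_mult tr_diff tr_power

text \<open>Division by minimisation. A power of 2 is never 0, so the minimisation is regular at all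
  arguments.\<close>

lemma tr_div_power2:
  assumes "total_recursive f" "total_recursive g"
  shows "total_recursive (\<lambda>xs. f xs div 2 ^ g xs)"
proof -
  have eq: "x div 2 ^ i = (LEAST q. Suc x - Suc q * 2 ^ i = 0)" for x i :: nat
  proof (rule Least_equality[symmetric])
    have "x < 2 ^ i + 2 ^ i * (x div 2 ^ i)" using dividend_less_times_div[of "2 ^ i" x] by simp
    then show "Suc x - Suc (x div 2 ^ i) * 2 ^ i = 0" by (simp add: mult.commute)
  next
    fix q assume "Suc x - Suc q * 2 ^ i = 0"
    then have "x < Suc q * 2 ^ i" by simp
    then show "x div 2 ^ i \<le> q" by (simp add: less_mult_imp_div_less less_Suc_eq_le[symmetric])
  qed
  have "total_recursive (\<lambda>xs. Suc (arg 1 xs) - Suc (arg 0 xs) * 2 ^ arg 2 xs)"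
    by (intro tr_intros)
  moreover have "\<exists>j. Suc x - Suc j * 2 ^ y = 0" for x y :: nat
  proof (rule exI[of _ x])
    have "Suc x * 1 \<le> Suc x * 2 ^ y" by (intro mult_left_mono) simp_all
    then show "Suc x - Suc x * 2 ^ y = 0" by (simp only: diff_is_0_eq mult_1_right)
  qed
  ultimately show ?thesis
    unfolding eq using assms by (rule tr_least)
qed

section \<open>Effective approximation\<close>

text \<open>Run lengths, in the sense of \<open>word\<close>, of a word leading to each letter.
  Their length is at most 13, and with the \<open>k + 3\<close> digits kept in
  \<open>dev_approx\<close> this gives the exponent \<open>k + 16\<close>; the 3 meets the
  hypothesis of \<open>weight_tail\<close>.\<close>

primrec access :: "letter \<Rightarrow> nat list" where
  "access S = []" | "access Q1 = [0]" | "access Q2 = [1]" | "access Q3 = [2]" | "access Q4 = [3]"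
| "access Q5 = [4]" | "access Q7 = [5]" | "access Q8 = [4, 0]" | "access Q9 = [6]"
| "access Q10 = [5, 0]" | "access Q11 = [4, 1]" | "access Q12 = [6, 0]" | "access Q13 = [5, 1]"
| "access Q14 = [4, 2]" | "access Q15 = [6, 1]" | "access Q16 = [5, 2]" | "access Q17 = [4, 3]"
| "access Q18 = [6, 2]" | "access Q19 = [5, 3]" | "access Q20 = [4, 4]" | "access Q22 = [6, 3]"
| "access Q23 = [5, 4]" | "access Q24 = [4, 5]" | "access Q25 = [5, 5]" | "access Q26 = [4, 6]"
| "access Q27 = [5, 5, 0]"

lemma access: "path (N S) (word (access x)) = Some (N x) \<and> length (word (access x)) \<le> 13"
  by (cases x; hypsubst; code_simp)

lemma U_le_power2: "U p \<le> 2 ^ p"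
  by (induction p rule: U.induct) auto

text \<open>The leading digits only matter through the state they lead to, up to an exponentially small
  error, so they can be replaced by an access word of that state.\<close>

lemma dev_approx: "\<exists>n'<2 ^ (k + 16). \<bar>dev n - dev n'\<bar> \<le> 12.4 * 0.87 ^ k"
proof -
  obtain w where w: "length w = n + (k + 3)" "path (N S) w = Some (state n)" "val w = n"
    using ex_word[of n "n + (k + 3)"] U_ge[of "n + (k + 3)"] by auto
  define h l where "h = take n w" and "l = drop n w"
  have hl: "w = h @ l" "length l = k + 3" using w(1) by (simp_all add: h_def l_def)
  obtain q where q: "path (N S) h = Some q" "path q l = Some (state n)"
    using w(2) unfolding hl(1) path_append by (auto split: option.splits)
  from hl(2) obtain c u where "l = c # u" by (cases l) auto
  with q(2) have "psi q \<noteq> []" by (auto simp: step_def)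
  then obtain x where x: "q = N x" by (cases q) auto
  define v where "v = word (access x)"
  have p: "path (N S) (v @ l) = Some (state n)" and lv: "length v \<le> 13"
    using access[of x] q(2) x by (simp_all add: v_def path_append)
  have "val (v @ l) < U (length (v @ l))" using val_less_cap[OF p] by simp
  also have "\<dots> \<le> 2 ^ length (v @ l)" by (rule U_le_power2)
  also have "\<dots> \<le> 2 ^ (k + 16)" using hl(2) lv by (intro power_increasing) auto
  finally have less: "val (v @ l) < 2 ^ (k + 16)" .
  have "dev n - dev (val (v @ l)) =
      weight (\<lambda>p. theta (p + (k + 3))) h - weight (\<lambda>p. theta (p + (k + 3))) v"
    using dev_val[OF w(2)] dev_val[OF p] unfolding w(3) by (simp add: hl weight_append)
  also have "\<bar>\<dots>\<bar> \<le> \<bar>weight (\<lambda>p. theta (p + (k + 3))) h\<bar> + \<bar>weight (\<lambda>p. theta (p + (k + 3))) v\<bar>"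
    by (rule abs_triangle_ineq4)
  also have "\<dots> \<le> 6.2 * 0.87 ^ (k + 3) + 6.2 * 0.87 ^ (k + 3)"
    by (intro add_mono weight_tail) simp_all
  also have "\<dots> = 12.4 * 0.87 ^ (k + 3)" by simp
  also have "\<dots> \<le> 12.4 * 0.87 ^ k" by (intro mult_left_mono power_decreasing) simp_all
  finally show ?thesis using less by blast
qed

text \<open>Storing the differences as binary digits of one number turns the course-of-values recursion
  for the solution into a primitive recursion.\<close>

definition code :: "nat \<Rightarrow> nat" where
  "code n = (\<Sum>i<n. nat (D_of (state i)) * 2 ^ i)"

text \<open>The summand is the binary digit \<open>i\<close> of \<open>r\<close>, expressed by the
  operations shown to be recursive.\<close>

definition prefix_sum :: "nat \<Rightarrow> nat \<Rightarrow> nat" where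
  "prefix_sum r m = (\<Sum>i<m. r div 2 ^ i - 2 * (r div 2 ^ Suc i))"

lemma code_digit:
  assumes "i < n"
  shows "code n div 2 ^ i - 2 * (code n div 2 ^ Suc i) = nat (D_of (state i))"
proof -
  have d: "nat (D_of q) < 2" for q using D_of_range[of q] by auto
  have less: "code i < 2 ^ i" for i
  proof (induction i)
    case (Suc i)
    have "nat (D_of (state i)) * 2 ^ i \<le> 1 * 2 ^ i"
      using d[of "state i"] by (intro mult_right_mono) auto
    then show ?case using Suc unfolding code_def sum.lessThan_Suc power_Suc by linarith
  qed (simp add: code_def)
  have "\<exists>c. code (Suc i + m) = code (Suc i) + c * 2 ^ Suc i" for m
  proof (induction m)
    case (Suc m)
    then obtain c where "code (Suc i + m) = code (Suc i) + c * 2 ^ Suc i" by blast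
    then show ?case
      by (intro exI[of _ "c + nat (D_of (state (Suc i + m))) * 2 ^ m"])
         (simp add: code_def algebra_simps power_add)
  qed (intro exI[of _ 0], simp)
  then obtain c where "code n = code (Suc i) + c * 2 ^ Suc i"
    using assms by (metis Suc_leI le_add_diff_inverse)
  then have n: "code n = code i + (nat (D_of (state i)) + 2 * c) * 2 ^ i"
    by (simp add: code_def algebra_simps)
  have 1: "code n div 2 ^ i = nat (D_of (state i)) + 2 * c"
    unfolding n using less[of i] by simp
  have "code n div 2 ^ Suc i = (code n div 2 ^ i) div 2"
    by (simp only: power_Suc2 div_mult2_eq)
  then have "code n div 2 ^ Suc i = c" unfolding 1 using d[of "state i"] by simp
  with 1 show ?thesis by simp
qed

lemma prefix_sum_code: "m \<le> n \<Longrightarrow> prefix_sum (code n) m = sol m"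
proof -
  assume "m \<le> n"
  then have "prefix_sum (code n) m = (\<Sum>i<m. nat (D_of (state i)))"
    unfolding prefix_sum_def by (intro sum.cong code_digit) auto
  also have "\<dots> = sol m"
  proof (induction m)
    case (Suc m)
    then show ?case using sol_Suc[of m] D_of_range[of "state m"] by auto
  qed (simp add: sol_0)
  finally show ?thesis .
qed

text \<open>The factor of \<open>2 ^ n\<close> is \<open>sol (Suc n) - sol n\<close> with the first
  term expanded by the recurrence. For \<open>n > 0\<close> its arguments are at most
  \<open>n\<close>, so the digits stored so far suffice.\<close>

definition code_next :: "nat \<Rightarrow> nat \<Rightarrow> nat" where
  "code_next r n = r + 2 ^ n * (Suc n - prefix_sum r (Suc n - prefix_sum r (Suc n - prefix_sum r n))
     - prefix_sum r n)"

lemma code_Suc: "code (Suc n) = code_next (code n) n"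
proof -
  have "Suc n - prefix_sum (code n) (Suc n - prefix_sum (code n) (Suc n - prefix_sum (code n) n))
      - prefix_sum (code n) n = nat (D_of (state n))"
  \<comment> \<open>At 0 the arguments exceed \<open>n\<close>, but all prefix sums of the empty
    code are 0 and the formula still yields the correct digit 1.\<close>
  proof (cases "n = 0")
    case True
    then show ?thesis by (simp add: code_def prefix_sum_def state_0)
  next
    case False
    have 1: "0 < sol n" "sol n \<le> n" using False sol_pos sol_le by auto
    then have 2: "0 < sol (Suc n - sol n)" using sol_pos by simp
    have "prefix_sum (code n) n = sol n" by (simp add: prefix_sum_code)
    moreover have "prefix_sum (code n) (Suc n - sol n) = sol (Suc n - sol n)"
      using 1 by (simp add: prefix_sum_code)
    moreover have "prefix_sum (code n) (Suc n - sol (Suc n - sol n)) = sol (Suc n - sol (Suc n - sol n))"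
      using 2 by (simp add: prefix_sum_code)
    moreover have "sol (Suc n) = sol n + nat (D_of (state n))"
      using sol_Suc[of n] D_of_range[of "state n"] by auto
    moreover have "Suc n - z - y = d" if "y + d + z = Suc n" for y d z using that by linarith
    ultimately show ?thesis using sol_rec(3)[of n] by simp
  qed
  then show ?thesis by (simp add: code_next_def code_def mult.commute)
qed

lemma tr_prefix_sum:
  assumes "total_recursive f" "total_recursive g"
  shows "total_recursive (\<lambda>xs. prefix_sum (f xs) (g xs))"
proof -
  have "total_recursive (\<lambda>xs. arg 1 xs div 2 ^ arg 0 xs - 2 * (arg 1 xs div 2 ^ Suc (arg 0 xs)))"
    by (intro tr_intros tr_div_power2)
  then show ?thesis
    unfolding prefix_sum_def
    using tr_sum[of "\<lambda>i r y. r div 2 ^ i - 2 * (r div 2 ^ Suc i)" g f f] assms by simp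
qed

lemma tr_sol:
  assumes "total_recursive f"
  shows "total_recursive (\<lambda>xs. sol (f xs))"
proof -
  have "total_recursive (\<lambda>xs. code_next (arg 0 xs) (arg 1 xs))"
    unfolding code_next_def by (intro tr_intros tr_prefix_sum)
  then have "total_recursive (\<lambda>xs. rec_nat 0 (\<lambda>i r. code_next r i) (f xs))"
    using tr_rec[of "\<lambda>x y. 0" "\<lambda>r i x y. code_next r i" f f f] assms tr_const by simp
  moreover have "rec_nat 0 (\<lambda>i r. code_next r i) n = code n" for n
    by (induction n) (simp_all add: code_Suc, simp add: code_def)
  ultimately have "total_recursive (\<lambda>xs. prefix_sum (code (f xs)) (f xs))"
    using assms by (intro tr_prefix_sum) simp_all
  then show ?thesis by (simp add: prefix_sum_code)
qed

section \<open>Rational approximation of the root and of the extrema\<close>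

text \<open>For \<open>t > 0\<close> this is the floor of \<open>cubic_root * t\<close>: clearing
  denominators, the truncated difference vanishes iff the cubic is positive at
  \<open>(j + 1) / t\<close>.\<close>

definition scaled_root :: "nat \<Rightarrow> nat" where
  "scaled_root t = (LEAST j. Suc (Suc j ^ 2 * t + t ^ 3) - (Suc j ^ 3 + 2 * Suc j * t ^ 2) = 0)"

lemma scaled_root_exists: "\<exists>j. Suc (Suc j ^ 2 * t + t ^ 3) - (Suc j ^ 3 + 2 * Suc j * t ^ 2) = (0 :: nat)"
proof (cases t)
  case (Suc i)
  \<comment> \<open>This choice makes \<open>Suc j = t\<close>: the cubic is positive at 1.\<close>
  then show ?thesis by (intro exI[of _ i]) (simp add: power3_eq_cube power2_eq_square)
qed simp

lemma scaled_root_criterion: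
  assumes "0 < t"
  shows "Suc (Suc j ^ 2 * t + t ^ 3) - (Suc j ^ 3 + 2 * Suc j * t ^ 2) = 0 \<longleftrightarrow>
    cubic_root * real t < real (Suc j)"
proof -
  have t: "real t > 0" using assms by simp
  have "Suc (Suc j ^ 2 * t + t ^ 3) - (Suc j ^ 3 + 2 * Suc j * t ^ 2) = 0 \<longleftrightarrow>
      Suc j ^ 2 * t + t ^ 3 < Suc j ^ 3 + 2 * Suc j * t ^ 2" by auto
  also have "\<dots> \<longleftrightarrow> real (Suc j ^ 2 * t + t ^ 3) < real (Suc j ^ 3 + 2 * Suc j * t ^ 2)"
    by (rule of_nat_less_iff[symmetric])
  also have "\<dots> \<longleftrightarrow> real (Suc j) ^ 2 * real t + real t ^ 3 < real (Suc j) ^ 3 + 2 * real (Suc j) * real t ^ 2"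
    by (simp only: of_nat_add of_nat_mult of_nat_power of_nat_numeral)
  also have "\<dots> \<longleftrightarrow> 1 < (real (Suc j) / real t) ^ 3 - (real (Suc j) / real t) ^ 2 + 2 * (real (Suc j) / real t)"
    using t by (simp add: field_simps power3_eq_cube power2_eq_square del: of_nat_Suc)
  also have "\<dots> \<longleftrightarrow> cubic_root < real (Suc j) / real t" by (rule cubic_root_less_iff[symmetric])
  also have "\<dots> \<longleftrightarrow> cubic_root * real t < real (Suc j)" using t by (simp add: field_simps del: of_nat_Suc)
  finally show ?thesis .
qed

lemma scaled_root:
  assumes "0 < t"
  shows "real (scaled_root t) \<le> cubic_root * real t" "cubic_root * real t < real (scaled_root t) + 1"
proof -
  show "cubic_root * real t < real (scaled_root t) + 1"
    using LeastI_ex[OF scaled_root_exists[of t]] scaled_root_criterion[OF assms, of "scaled_root t"]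
    by (simp add: scaled_root_def)
  show "real (scaled_root t) \<le> cubic_root * real t"
  proof (cases "scaled_root t")
    case 0
    then show ?thesis using cubic_root_bounds by simp
  next
    case (Suc j)
    then have "\<not> (Suc (Suc j ^ 2 * t + t ^ 3) - (Suc j ^ 3 + 2 * Suc j * t ^ 2) = 0)"
      unfolding scaled_root_def by (intro not_less_Least) simp
    then show ?thesis unfolding scaled_root_criterion[OF assms] Suc by simp
  qed
qed

lemma tr_scaled_root:
  assumes "total_recursive f"
  shows "total_recursive (\<lambda>xs. scaled_root (f xs))"
proof -
  have "total_recursive (\<lambda>xs. Suc (Suc (arg 0 xs) ^ 2 * arg 1 xs + arg 1 xs ^ 3) -
      (Suc (arg 0 xs) ^ 3 + 2 * Suc (arg 0 xs) * arg 1 xs ^ 2))"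
    by (intro tr_intros)
  then show ?thesis
    unfolding scaled_root_def
    using tr_least[of "\<lambda>j t y. Suc (Suc j ^ 2 * t + t ^ 3) - (Suc j ^ 3 + 2 * Suc j * t ^ 2)" f f]
      assms scaled_root_exists by simp
qed

lemma computable_funI: "total_recursive F \<Longrightarrow> (\<And>k. F [k] = f k) \<Longrightarrow> computable_fun f"
  unfolding computable_fun_def by blast

lemma computable_rat_seqI:
  assumes "total_recursive (\<lambda>xs. p (arg 0 xs))" "total_recursive (\<lambda>xs. q (arg 0 xs))"
    "total_recursive (\<lambda>xs. r (arg 0 xs))" "\<And>k. 0 < r k"
    and "\<And>k. real_of_rat (x k) = (real (p k) - real (q k)) / real (r k)"
  shows "computable_rat_seq x"
  unfolding computable_rat_seq_def
proof (intro exI conjI allI)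
  show "computable_fun p" by (rule computable_funI[OF assms(1)]) simp
  show "computable_fun q" by (rule computable_funI[OF assms(2)]) simp
  show "computable_fun (\<lambda>k. r k - 1)"
    by (rule computable_funI[OF tr_diff[OF assms(3) tr_const[of 1]]]) simp
  fix k
  have "real_of_rat (x k) = real_of_rat ((of_nat (p k) - of_nat (q k)) / of_nat (Suc (r k - 1)))"
    using assms(4)[of k] assms(5)[of k] by (simp add: of_rat_divide of_rat_diff)
  then show "x k = (of_nat (p k) - of_nat (q k)) / of_nat (Suc (r k - 1))"
    by (simp only: of_rat_eq_iff)
qed

text \<open>The square of the number of candidates \<open>n\<close>, so that replacing
  \<open>cubic_root\<close> by a multiple of \<open>1 / scale k\<close> costs at most
  \<open>2 ^ (- (k + 16))\<close> in \<open>dev n\<close>.\<close>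

definition scale :: "nat \<Rightarrow> nat" where
  "scale k = (2 ^ (k + 16)) ^ 2"

text \<open>The offset 2 exceeds all deviations in absolute value, so no subtraction is truncated.
  \<open>lower_max\<close> likewise approximates the maximum of \<open>2 - dev n\<close>.\<close>

definition upper_max :: "nat \<Rightarrow> nat" where
  "upper_max k = max_below (2 ^ (k + 16))
     (\<lambda>n. sol n * scale k + 2 * scale k - n * scaled_root (scale k))"

definition lower_max :: "nat \<Rightarrow> nat" where
  "lower_max k = max_below (2 ^ (k + 16))
     (\<lambda>n. 2 * scale k + n * scaled_root (scale k) - sol n * scale k)"

lemma scale_pos: "0 < scale k"
  by (simp add: scale_def)

lemma scaled_dev:
  assumes "n < 2 ^ (k + 16)"
  shows "dev n + 2 \<le> real (sol n * scale k + 2 * scale k - n * scaled_root (scale k)) / real (scale k)"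
    "real (sol n * scale k + 2 * scale k - n * scaled_root (scale k)) / real (scale k)
      \<le> dev n + 2 + 0.6 * 0.87 ^ k"
    "2 - dev n - 0.6 * 0.87 ^ k
      \<le> real (2 * scale k + n * scaled_root (scale k) - sol n * scale k) / real (scale k)"
    "real (2 * scale k + n * scaled_root (scale k) - sol n * scale k) / real (scale k) \<le> 2 - dev n"
proof -
  define t where "t = real (scale k)"
  define c where "c = real (scaled_root (scale k))"
  have t: "t > 0" using scale_pos by (simp add: t_def)
  have c: "c \<le> cubic_root * t" "cubic_root * t < c + 1"
    using scaled_root[OF scale_pos] by (simp_all add: t_def c_def)
  \<comment> \<open>The error from rounding the root; nonnegative because the root is rounded
    down.\<close>
  define e where "e = real n * (cubic_root - c / t)"
  have "c / t \<le> cubic_root" using c(1) t by (simp add: field_simps)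
  then have e0: "0 \<le> e" unfolding e_def by (intro mult_nonneg_nonneg) simp_all
  have "cubic_root < (c + 1) / t" using c(2) t by (simp add: pos_less_divide_eq)
  then have "e \<le> real n * (1 / t)"
    unfolding e_def by (intro mult_left_mono) (simp_all add: add_divide_distrib)
  also have "\<dots> \<le> 2 ^ (k + 16) * (1 / t)"
  proof (rule mult_right_mono)
    have "real n \<le> real (2 ^ (k + 16))" using assms by (simp only: of_nat_le_iff)
    then show "real n \<le> 2 ^ (k + 16)" by simp
  qed (use t in simp)
  also have "\<dots> = (1 / 2) ^ (k + 16)"
    by (simp add: t_def scale_def power2_eq_square power_divide)
  also have "\<dots> = (1 / 2) ^ k * (1 / 2) ^ 16" by (rule power_add)
  \<comment> \<open>Deliberately crude: the rounding error is put at the rate of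
    \<open>dev_approx\<close>, and 0.6 completes 12.4 to 13.\<close>
  also have "\<dots> \<le> 0.87 ^ k * 0.6"
    by (intro mult_mono power_mono) (simp_all add: power_divide)
  finally have e1: "e \<le> 0.6 * 0.87 ^ k" by simp
  have "e \<le> 0.6" using e1 power_le_one[of "0.87 :: real" k] by simp
  have 1: "real (sol n) + 2 - real n * (c / t) = dev n + 2 + e"
    and 2: "2 + real n * (c / t) - real (sol n) = 2 - dev n - e"
    by (simp_all add: dev_def e_def algebra_simps)
  have pos: "0 \<le> dev n + 2 + e" "0 \<le> 2 - dev n - e"
    using dev_range[of n] e0 \<open>e \<le> 0.6\<close> by simp_all
  have a: "real n * c \<le> real (sol n) * t + 2 * t"
    using pos(1) t unfolding 1[symmetric] by (simp add: field_simps)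
  then have "real (n * scaled_root (scale k)) \<le> real (sol n * scale k + 2 * scale k)"
    by (simp add: t_def c_def)
  then have "real (sol n * scale k + 2 * scale k - n * scaled_root (scale k)) =
      real (sol n) * t + 2 * t - real n * c"
    unfolding of_nat_le_iff by (simp add: of_nat_diff t_def c_def)
  then have A: "real (sol n * scale k + 2 * scale k - n * scaled_root (scale k)) / t = dev n + 2 + e"
    using t unfolding 1[symmetric] by (simp add: field_simps)
  have b: "real (sol n) * t \<le> 2 * t + real n * c"
    using pos(2) t unfolding 2[symmetric] by (simp add: field_simps)
  then have "real (sol n * scale k) \<le> real (2 * scale k + n * scaled_root (scale k))"
    by (simp add: t_def c_def)
  then have "real (2 * scale k + n * scaled_root (scale k) - sol n * scale k) =
      2 * t + real n * c - real (sol n) * t"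
    unfolding of_nat_le_iff by (simp add: of_nat_diff t_def c_def)
  then have B: "real (2 * scale k + n * scaled_root (scale k) - sol n * scale k) / t = 2 - dev n - e"
    using t unfolding 2[symmetric] by (simp add: field_simps)
  show "dev n + 2 \<le> real (sol n * scale k + 2 * scale k - n * scaled_root (scale k)) / real (scale k)"
    "real (sol n * scale k + 2 * scale k - n * scaled_root (scale k)) / real (scale k)
      \<le> dev n + 2 + 0.6 * 0.87 ^ k"
    "2 - dev n - 0.6 * 0.87 ^ k
      \<le> real (2 * scale k + n * scaled_root (scale k) - sol n * scale k) / real (scale k)"
    "real (2 * scale k + n * scaled_root (scale k) - sol n * scale k) / real (scale k) \<le> 2 - dev n"
    using A B e0 e1 unfolding t_def by simp_all
qed

lemma bdd_dev: "bdd_above (range dev)" "bdd_below (range dev)"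
  using dev_range by (auto intro!: bdd_aboveI[of _ "116 / 100"] bdd_belowI[of _ "- 105 / 100"] less_imp_le
    simp del: minus_divide_left[symmetric])

lemma sup_dev_approx:
  "\<bar>(SUP n. dev n) - (real (upper_max k) / real (scale k) - 2)\<bar> \<le> 13 * 0.87 ^ k"
proof -
  let ?h = "\<lambda>n. sol n * scale k + 2 * scale k - n * scaled_root (scale k)"
  obtain n where n: "n < 2 ^ (k + 16)" "upper_max k = ?h n"
    using max_below_attained[of "2 ^ (k + 16)" ?h] by (auto simp: upper_max_def)
  have "real (upper_max k) / real (scale k) - 2 \<le> dev n + 0.6 * 0.87 ^ k"
    using scaled_dev(2)[OF n(1)] n(2) by simp
  moreover have "dev n \<le> (SUP n. dev n)" by (rule cSUP_upper) (simp_all add: bdd_dev)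
  ultimately have 1: "real (upper_max k) / real (scale k) - 2 \<le> (SUP n. dev n) + 0.6 * 0.87 ^ k"
    by linarith
  have "dev m \<le> real (upper_max k) / real (scale k) - 2 + 12.4 * 0.87 ^ k" for m
  proof -
    obtain n' where n': "n' < 2 ^ (k + 16)" "\<bar>dev m - dev n'\<bar> \<le> 12.4 * 0.87 ^ k"
      using dev_approx by blast
    have "real (?h n') \<le> real (upper_max k)"
      using max_below_ge[OF n'(1), of ?h] unfolding upper_max_def by (simp only: of_nat_le_iff)
    then have "real (?h n') / real (scale k) \<le> real (upper_max k) / real (scale k)"
      by (rule divide_right_mono) simp
    then show ?thesis using scaled_dev(1)[OF n'(1)] n'(2) by linarith
  qed
  then have 2: "(SUP n. dev n) \<le> real (upper_max k) / real (scale k) - 2 + 12.4 * 0.87 ^ k"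
    by (intro cSUP_least) simp_all
  have "0 \<le> (0.87 :: real) ^ k" by simp
  with 1 2 show ?thesis by (simp add: abs_le_iff)
qed

text \<open>The rounding error and the error of \<open>dev_approx\<close> fall on the same side
  here, which is where the full constant 13 is used; for the supremum they fall on opposite
  sides.\<close>

lemma inf_dev_approx:
  "\<bar>(INF n. dev n) - (2 - real (lower_max k) / real (scale k))\<bar> \<le> 13 * 0.87 ^ k"
proof -
  let ?h = "\<lambda>n. 2 * scale k + n * scaled_root (scale k) - sol n * scale k"
  obtain n where n: "n < 2 ^ (k + 16)" "lower_max k = ?h n"
    using max_below_attained[of "2 ^ (k + 16)" ?h] by (auto simp: lower_max_def)
  have "dev n \<le> 2 - real (lower_max k) / real (scale k)"
    using scaled_dev(4)[OF n(1)] n(2) by simp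
  moreover have "(INF n. dev n) \<le> dev n" by (rule cINF_lower) (simp_all add: bdd_dev)
  ultimately have 1: "(INF n. dev n) \<le> 2 - real (lower_max k) / real (scale k)"
    by linarith
  have "2 - real (lower_max k) / real (scale k) - 13 * 0.87 ^ k \<le> dev m" for m
  proof -
    obtain n' where n': "n' < 2 ^ (k + 16)" "\<bar>dev m - dev n'\<bar> \<le> 12.4 * 0.87 ^ k"
      using dev_approx by blast
    have "real (?h n') \<le> real (lower_max k)"
      using max_below_ge[OF n'(1), of ?h] unfolding lower_max_def by (simp only: of_nat_le_iff)
    then have "real (?h n') / real (scale k) \<le> real (lower_max k) / real (scale k)"
      by (rule divide_right_mono) simp
    moreover have "dev n' \<le> dev m + 12.4 * 0.87 ^ k" using n'(2) by linarith
    ultimately show ?thesis using scaled_dev(3)[OF n'(1)] by simp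
  qed
  then have 2: "2 - real (lower_max k) / real (scale k) - 13 * 0.87 ^ k \<le> (INF n. dev n)"
    by (intro cINF_greatest) simp_all
  have "0 \<le> (0.87 :: real) ^ k" by simp
  with 1 2 show ?thesis by (simp add: abs_le_iff)
qed

lemma tr_scale: "total_recursive f \<Longrightarrow> total_recursive (\<lambda>xs. scale (f xs))"
  unfolding scale_def by (intro tr_intros)

lemma tr_upper_max: "total_recursive (\<lambda>xs. upper_max (arg 0 xs))"
proof -
  have h: "total_recursive (\<lambda>xs. sol (arg 0 xs) * arg 1 xs + 2 * arg 1 xs - arg 0 xs * scaled_root (arg 1 xs))"
    by (intro tr_intros tr_sol tr_scaled_root)
  show ?thesis
    unfolding upper_max_def
    by (rule tr_max_below[of "\<lambda>n t y. sol n * t + 2 * t - n * scaled_root t" "\<lambda>xs. 2 ^ (arg 0 xs + 16)"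
          "\<lambda>xs. scale (arg 0 xs)" "\<lambda>xs. 0", OF h]) (intro tr_intros tr_scale)+
qed

lemma tr_lower_max: "total_recursive (\<lambda>xs. lower_max (arg 0 xs))"
proof -
  have h: "total_recursive (\<lambda>xs. 2 * arg 1 xs + arg 0 xs * scaled_root (arg 1 xs) - sol (arg 0 xs) * arg 1 xs)"
    by (intro tr_intros tr_sol tr_scaled_root)
  show ?thesis
    unfolding lower_max_def
    by (rule tr_max_below[of "\<lambda>n t y. 2 * t + n * scaled_root t - sol n * t" "\<lambda>xs. 2 ^ (arg 0 xs + 16)"
          "\<lambda>xs. scale (arg 0 xs)" "\<lambda>xs. 0", OF h]) (intro tr_intros tr_scale)+
qed

lemma effectively_approximable_dev: "effectively_approximable (INF n. dev n) (SUP n. dev n)"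
proof -
  define err :: "nat \<Rightarrow> rat" where "err k = 13 * 87 ^ k / 100 ^ k" for k
  define y :: "nat \<Rightarrow> rat" where "y k = of_nat (upper_max k) / of_nat (scale k) - 2" for k
  define x :: "nat \<Rightarrow> rat" where "x k = 2 - of_nat (lower_max k) / of_nat (scale k)" for k
  have err: "real_of_rat (err k) = 13 * 0.87 ^ k" for k
    by (simp add: err_def of_rat_divide of_rat_mult of_rat_power power_divide)
  have y: "real_of_rat (y k) = real (upper_max k) / real (scale k) - 2" for k
    by (simp add: y_def of_rat_divide of_rat_diff)
  have x: "real_of_rat (x k) = 2 - real (lower_max k) / real (scale k)" for k
    by (simp add: x_def of_rat_divide of_rat_diff)
  note tr = tr_intros tr_scale tr_upper_max tr_lower_max
  have pos: "0 < scale k * 100 ^ k" for k using scale_pos by simp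
  have "computable_rat_seq (\<lambda>k. y k - err k)"
    by (rule computable_rat_seqI[where p = "\<lambda>k. upper_max k * 100 ^ k"
          and q = "\<lambda>k. 2 * scale k * 100 ^ k + 13 * 87 ^ k * scale k" and r = "\<lambda>k. scale k * 100 ^ k"])
       ((intro tr)+, rule pos, use scale_pos in \<open>simp add: of_rat_diff err y field_simps power_divide\<close>)
  moreover have "computable_rat_seq (\<lambda>k. y k + err k)"
    by (rule computable_rat_seqI[where p = "\<lambda>k. upper_max k * 100 ^ k + 13 * 87 ^ k * scale k"
          and q = "\<lambda>k. 2 * scale k * 100 ^ k" and r = "\<lambda>k. scale k * 100 ^ k"])
       ((intro tr)+, rule pos, use scale_pos in \<open>simp add: of_rat_add err y field_simps power_divide\<close>)
  moreover have "computable_rat_seq (\<lambda>k. x k - err k)"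
    by (rule computable_rat_seqI[where p = "\<lambda>k. 2 * scale k * 100 ^ k"
          and q = "\<lambda>k. lower_max k * 100 ^ k + 13 * 87 ^ k * scale k" and r = "\<lambda>k. scale k * 100 ^ k"])
       ((intro tr)+, rule pos, use scale_pos in \<open>simp add: of_rat_diff err x field_simps power_divide\<close>)
  moreover have "computable_rat_seq (\<lambda>k. x k + err k)"
    by (rule computable_rat_seqI[where p = "\<lambda>k. 2 * scale k * 100 ^ k + 13 * 87 ^ k * scale k"
          and q = "\<lambda>k. lower_max k * 100 ^ k" and r = "\<lambda>k. scale k * 100 ^ k"])
       ((intro tr)+, rule pos, use scale_pos in \<open>simp add: of_rat_add err x field_simps power_divide\<close>)
  moreover have "computable_rat_seq (\<lambda>k. 2 * err k)"
    by (rule computable_rat_seqI[where p = "\<lambda>k. 26 * 87 ^ k" and q = "\<lambda>k. 0" and r = "\<lambda>k. 100 ^ k"])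
       ((intro tr)+, simp, simp add: of_rat_mult err power_divide)
  moreover have "(\<lambda>k. real_of_rat (2 * err k)) \<longlonglongrightarrow> 0"
  proof -
    have "(\<lambda>k. 26 * (0.87 :: real) ^ k) \<longlonglongrightarrow> 26 * 0"
      by (intro tendsto_mult tendsto_const LIMSEQ_realpow_zero) simp_all
    then show ?thesis by (simp add: of_rat_mult err)
  qed
  moreover have "of_rat (x k - err k) \<le> (INF n. dev n) \<and> (INF n. dev n) \<le> of_rat (x k + err k) \<and>
      of_rat (y k - err k) \<le> (SUP n. dev n) \<and> (SUP n. dev n) \<le> of_rat (y k + err k) \<and>
      x k + err k - (x k - err k) \<le> 2 * err k \<and> y k + err k - (y k - err k) \<le> 2 * err k" for k
    using sup_dev_approx[of k] inf_dev_approx[of k]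
    unfolding of_rat_diff of_rat_add x y err abs_le_iff by (intro conjI) (linarith | simp)+
  ultimately show ?thesis unfolding effectively_approximable_def by blast
qed

theorem theorem1p1:
  "(\<exists>!a. nested_recurrence a) \<and>
   (\<forall>a. nested_recurrence a \<longrightarrow>
      (\<forall>n. \<exists>e d. output_on E_aut (rep n) = Some e \<and> output_on D_aut (rep n) = Some d \<and>
             int (a n) = int (shift2 n) + e \<and>
             int (a (n + 1)) - int (a n) = d \<and> d \<in> {0, 1}) \<and>
      (\<forall>n. - 1.049234 < real (a n) - cubic_root * real n \<and>
           real (a n) - cubic_root * real n < 1.155081) \<and>
      (\<lambda>n. real (a n) / real n) \<longlonglongrightarrow> cubic_root \<and>
      {int (a n) - \<lfloor>cubic_root * real n\<rfloor> | n. n \<ge> 1} = {- 1, 0, 1, 2} \<and>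
      morphic (diff_word a) \<and>
      \<not> ultimately_periodic (diff_word a) \<and>
      least_balance_constant (diff_word a) 4 \<and>
      card (UNIV :: letter set) = 26 \<and> non_erasing nu \<and> non_erasing eta \<and>
      diff_word a = apply_morphism_inf eta (omega_word nu S) \<and>
      effectively_approximable
        (INF n. real (a n) - cubic_root * real n)
        (SUP n. real (a n) - cubic_root * real n))"
proof -
  have unique: "\<exists>!a. nested_recurrence a"
    using nested_recurrence_sol nested_recurrence_unique by blast
  have automata: "\<exists>e d. output_on E_aut (rep n) = Some e \<and> output_on D_aut (rep n) = Some d \<and>
      int (sol n) = int (shift2 n) + e \<and> int (sol (n + 1)) - int (sol n) = d \<and> d \<in> {0, 1}" for n
    using sol_automata[of n] sol_Suc[of n] D_of_range[of "state n"] by auto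
  have bounds: "- 1.049234 < real (sol n) - cubic_root * real n"
    "real (sol n) - cubic_root * real n < 1.155081" for n
    using dev_lower[of n] dev_upper[of n] unfolding dev_def by simp_all
  have approx: "effectively_approximable (INF n. real (sol n) - cubic_root * real n)
      (SUP n. real (sol n) - cubic_root * real n)"
    using effectively_approximable_dev by (simp only: dev_def)
  show ?thesis
    by (intro conjI allI impI; (drule nested_recurrence_unique, hypsubst)?)
       (rule unique automata bounds sol_limit floor_differences morphic_diff_word
         not_ultimately_periodic least_balance_constant_4 card_letter non_erasing
         diff_word_presentation approx)+
qed

end
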